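(* Let $\Lambda$ be a strongly connected finite $k$-graph, and let $M$ be the Perron-Frobenius measure on $\Lambda^\infty$. The measure space $(\Lambda^\infty, M)$, together with the prefixing maps $\{\sigma_\lambda: Z(s(\lambda)) \to Z(\lambda)\}_{\lambda \in \Lambda}$ given by $\sigma_\lambda(x) = \lambda x$ and the coding maps $\{\sigma^m:\Lambda^\infty\to\Lambda^\infty\}_{m \in \mathbb{N}^k}$ given by $\sigma^m(x)=x(m,\infty)$ (the shift by $m$), forms a $\Lambda$-semibranching function system.
   Context: Notation: $\mathbb N=\{0,1,2,\dots\}$, $k\ge 1$, and $e_1,\dots,e_k$ are the generators of $\mathbb N^k$. $k$-graphs: A $k$-graph is a countable category $\Lambda$ with a functor $d:\Lambda\to\mathbb N^k$ satisfying the factorization property: whenever $d(\lambda)=m+n$ there are unique $\mu,\nu\in\Lambda$ with $\lambda=\mu\nu$, $d(\mu)=m$, $d(\nu)=n$. $\Lambda^0$ is the set of identity morphisms (vertices), $r,s:\Lambda\to\Lambda^0$ are the range and source maps, $\Lambda^n=\{\lambda: d(\lambda)=n\}$, and $v\Lambda w=\{\lambda: r(\lambda)=v, s(\lambda)=w\}$, $v\Lambda^n=\{\lambda\in\Lambda^n: r(\lambda)=v\}$, etc. $\Lambda$ is finite if every $\Lambda^n$ is finite; it is strongly connected if $v\Lambda w\neq\emptyset$ for all $v,w\in\Lambda^0$. The vertex matrices are $A_i\in M_{\Lambda^0}(\mathbb N)$, $A_i(v,w)=|v\Lambda^{e_i}w|$, $1\le i\le k$. Infinite paths: $\Omega_k=\{(p,q)\in\mathbb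 N^k\times\mathbb N^k: p\le q\}$ is the $k$-graph with $r(p,q)=p$, $s(p,q)=q$, $(p,q)(q,m)=(p,m)$, $d(p,q)=q-p$. An infinite path is a $k$-graph morphism (degree-preserving functor) $x:\Omega_k\to\Lambda$; $\Lambda^\infty$ is the set of them. The cylinder sets $Z(\lambda)=\{x\in\Lambda^\infty: x(0,d(\lambda))=\lambda\}$ form a basis of its topology. The shift is $\sigma^p(x)(m,n)=x(m+p,n+p)$. For $x\in Z(s(\lambda))$, $\lambda x$ is the unique infinite path $y\in Z(\lambda)$ with $\sigma^{d(\lambda)}(y)=x$. Perron-Frobenius measure: For $\Lambda$ strongly connected and finite, $x^\Lambda$ denotes the unique vector with positive entries and $\ell^1$-norm one such that $A_ix^\Lambda=\rho(A_i)x^\Lambda$ for all $i$, where $\rho(A_i)$ is the spectral radius. Put $\rho(\Lambda)=(\rho(A_1),\dots,\rho(A_k))\in(0,\infty)^k$ and $\rho(\Lambda)^n=\prod_i\rho(A_i)^{n_i}$. $M$ is the Borel probability measure on $\Lambda^\infty$ with $M(Z(\lambda))=\rho(\Lambda)^{-d(\lambda)}x^\Lambda_{s(\lambda)}$ for all $\lambda\in\Lambda$. Semibranching function system: Let $(X,\mu)$ be a measure space and $I$ a finite index set. A family of measurable maps $\sigma_i:D_i\to X$ ($i\in I$, $D_i\subset X$ measurable) is a semibranching function system if, with $R_i=\sigma_i(D_i)$: $\mu(X\setminus\bigcup_iR_i)=0$ and $\mu(R_i\cap R_j)=0$ for $i\ne j$; and there is a Radon-Nikodym derivative $\Phi_{\sigma_i}=\frac{d(\mu\circ\sigma_i)}{d\mu}$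 with $\Phi_{\sigma_i}>0$ $\mu$-a.e. on $D_i$. A measurable $\sigma:X\to X$ is a coding map for $\{\sigma_i\}$ if $\sigma\circ\sigma_i(x)=x$ for all $x\in D_i$. $\Lambda$-semibranching function system: For a finite $k$-graph $\Lambda$ and a measure space $(X,\mu)$, this is a collection $\{D_\lambda\}_{\lambda\in\Lambda}$ of measurable subsets of $X$, prefixing maps $\{\tau_\lambda:D_\lambda\to X\}_{\lambda\in\Lambda}$, and coding maps $\{\tau^m:X\to X\}_{m\in\mathbb N^k}$ such that: (a) for each $m\in\mathbb N^k$, $\{\tau_\lambda: d(\lambda)=m\}$ is a semibranching function system with coding map $\tau^m$; (b) if $v\in\Lambda^0$ then $\tau_v=\mathrm{id}$ and $\mu(D_v)>0$; (c) with $R_\lambda=\tau_\lambda(D_\lambda)$, for each $\lambda\in\Lambda$ and $\nu\in s(\lambda)\Lambda$ we have $R_\nu\subseteq D_\lambda$ (up to a set of measure $0$) and $\tau_\lambda\tau_\nu=\tau_{\lambda\nu}$ a.e.; (d) $\tau^m\circ\tau^n=\tau^{m+n}$ for all $m,n\in\mathbb N^k$. *)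

theory Defs
  imports
    "HOL-Probability.Probability"
    "Jordan_Normal_Form.Spectral_Radius"
begin

text \<open>
  Categories are presented by their morphisms only: objects are identified with identity
  morphisms, so \<open>rng\<close> and \<open>src\<close> send a morphism to an identity morphism.  The number \<open>k\<close> is
  the cardinality of the finite index type \<open>'k\<close> (hence \<open>k \<ge> 1\<close>), and \<open>\<nat>\<^sup>k\<close> is \<open>nat ^ 'k\<close> with
  componentwise addition and order.
\<close>

record ('a, 'k::finite) kgraph =
  mor :: "'a set"
  rng :: "'a \<Rightarrow> 'a"
  src :: "'a \<Rightarrow> 'a"
  cmp :: "'a \<Rightarrow> 'a \<Rightarrow> 'a"
  deg :: "'a \<Rightarrow> nat ^ 'k"

locale small_category =
  fixes \<Lambda> :: "('a, 'k::finite) kgraph"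
  assumes rng_mor: "\<mu> \<in> mor \<Lambda> \<Longrightarrow> rng \<Lambda> \<mu> \<in> mor \<Lambda>"
    and src_mor: "\<mu> \<in> mor \<Lambda> \<Longrightarrow> src \<Lambda> \<mu> \<in> mor \<Lambda>"
    and rng_rng: "\<mu> \<in> mor \<Lambda> \<Longrightarrow> rng \<Lambda> (rng \<Lambda> \<mu>) = rng \<Lambda> \<mu>"
    and src_rng: "\<mu> \<in> mor \<Lambda> \<Longrightarrow> src \<Lambda> (rng \<Lambda> \<mu>) = rng \<Lambda> \<mu>"
    and rng_src: "\<mu> \<in> mor \<Lambda> \<Longrightarrow> rng \<Lambda> (src \<Lambda> \<mu>) = src \<Lambda> \<mu>"
    and src_src: "\<mu> \<in> mor \<Lambda> \<Longrightarrow> src \<Lambda> (src \<Lambda> \<mu>) = src \<Lambda> \<mu>"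
    and cmp_mor: "\<lbrakk>\<mu> \<in> mor \<Lambda>; \<nu> \<in> mor \<Lambda>; src \<Lambda> \<mu> = rng \<Lambda> \<nu>\<rbrakk> \<Longrightarrow> cmp \<Lambda> \<mu> \<nu> \<in> mor \<Lambda>"
    and rng_cmp: "\<lbrakk>\<mu> \<in> mor \<Lambda>; \<nu> \<in> mor \<Lambda>; src \<Lambda> \<mu> = rng \<Lambda> \<nu>\<rbrakk> \<Longrightarrow> rng \<Lambda> (cmp \<Lambda> \<mu> \<nu>) = rng \<Lambda> \<mu>"
    and src_cmp: "\<lbrakk>\<mu> \<in> mor \<Lambda>; \<nu> \<in> mor \<Lambda>; src \<Lambda> \<mu> = rng \<Lambda> \<nu>\<rbrakk> \<Longrightarrow> src \<Lambda> (cmp \<Lambda> \<mu> \<nu>) = src \<Lambda> \<nu>"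
    and cmp_assoc: "\<lbrakk>\<mu> \<in> mor \<Lambda>; \<nu> \<in> mor \<Lambda>; \<kappa> \<in> mor \<Lambda>; src \<Lambda> \<mu> = rng \<Lambda> \<nu>; src \<Lambda> \<nu> = rng \<Lambda> \<kappa>\<rbrakk>
      \<Longrightarrow> cmp \<Lambda> (cmp \<Lambda> \<mu> \<nu>) \<kappa> = cmp \<Lambda> \<mu> (cmp \<Lambda> \<nu> \<kappa>)"
    and rng_id: "\<mu> \<in> mor \<Lambda> \<Longrightarrow> cmp \<Lambda> (rng \<Lambda> \<mu>) \<mu> = \<mu>"
    and src_id: "\<mu> \<in> mor \<Lambda> \<Longrightarrow> cmp \<Lambda> \<mu> (src \<Lambda> \<mu>) = \<mu>"

locale k_graph = small_category +
  assumes countable_mor: "countable (mor \<Lambda>)"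
    and deg_id: "\<mu> \<in> mor \<Lambda> \<Longrightarrow> rng \<Lambda> \<mu> = \<mu> \<Longrightarrow> deg \<Lambda> \<mu> = 0"
    and deg_cmp: "\<lbrakk>\<mu> \<in> mor \<Lambda>; \<nu> \<in> mor \<Lambda>; src \<Lambda> \<mu> = rng \<Lambda> \<nu>\<rbrakk>
      \<Longrightarrow> deg \<Lambda> (cmp \<Lambda> \<mu> \<nu>) = deg \<Lambda> \<mu> + deg \<Lambda> \<nu>"
    and factorization: "\<lbrakk>\<kappa> \<in> mor \<Lambda>; deg \<Lambda> \<kappa> = m + n\<rbrakk>
      \<Longrightarrow> \<exists>!(\<mu>, \<nu>). \<mu> \<in> mor \<Lambda> \<and> \<nu> \<in> mor \<Lambda> \<and> src \<Lambda> \<mu> = rng \<Lambda> \<nu> \<and> \<kappa> = cmp \<Lambda> \<mu> \<nu>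
            \<and> deg \<Lambda> \<mu> = m \<and> deg \<Lambda> \<nu> = n"

definition vertices :: "('a, 'k::finite) kgraph \<Rightarrow> 'a set" where
  "vertices \<Lambda> = {v \<in> mor \<Lambda>. rng \<Lambda> v = v}"

definition paths :: "('a, 'k::finite) kgraph \<Rightarrow> nat ^ 'k \<Rightarrow> 'a set" where
  "paths \<Lambda> n = {\<mu> \<in> mor \<Lambda>. deg \<Lambda> \<mu> = n}"

definition finite_kgraph :: "('a, 'k::finite) kgraph \<Rightarrow> bool" where
  "finite_kgraph \<Lambda> \<longleftrightarrow> (\<forall>n. finite (paths \<Lambda> n))"

definition strongly_connected :: "('a, 'k::finite) kgraph \<Rightarrow> bool" where
  "strongly_connected \<Lambda> \<longleftrightarrow>
     (\<forall>v\<in>vertices \<Lambda>. \<forall>w\<in>vertices \<Lambda>. \<exists>\<mu>\<in>mor \<Lambda>. rng \<Lambda> \<mu> = v \<and> src \<Lambda> \<mu> = w)"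

definition vertex_matrix :: "('a, 'k::finite) kgraph \<Rightarrow> 'k \<Rightarrow> 'a \<Rightarrow> 'a \<Rightarrow> nat" where
  "vertex_matrix \<Lambda> i v w = card {\<mu> \<in> paths \<Lambda> (axis i 1). rng \<Lambda> \<mu> = v \<and> src \<Lambda> \<mu> = w}"

definition kgraph_morphism ::
    "('a, 'k::finite) kgraph \<Rightarrow> ('b, 'k) kgraph \<Rightarrow> ('a \<Rightarrow> 'b) \<Rightarrow> bool" where
  "kgraph_morphism \<Gamma> \<Lambda> f \<longleftrightarrow>
     (\<forall>\<mu>\<in>mor \<Gamma>. f \<mu> \<in> mor \<Lambda> \<and> rng \<Lambda> (f \<mu>) = f (rng \<Gamma> \<mu>) \<and> src \<Lambda> (f \<mu>) = f (src \<Gamma> \<mu>)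
        \<and> deg \<Lambda> (f \<mu>) = deg \<Gamma> \<mu>) \<and>
     (\<forall>\<mu>\<in>mor \<Gamma>. \<forall>\<nu>\<in>mor \<Gamma>. src \<Gamma> \<mu> = rng \<Gamma> \<nu> \<longrightarrow> f (cmp \<Gamma> \<mu> \<nu>) = cmp \<Lambda> (f \<mu>) (f \<nu>))"

text \<open>The object \<open>p\<close> of \<open>\<Omega>\<^sub>k\<close> is its identity morphism \<open>(p, p)\<close>.\<close>

definition Omega :: "((nat ^ 'k) \<times> (nat ^ 'k), 'k::finite) kgraph" where
  "Omega = \<lparr> mor = {(p, q). p \<le> q},
             rng = (\<lambda>(p, q). (p, p)),
             src = (\<lambda>(p, q). (q, q)),
             cmp = (\<lambda>(p, q) (q', m). (p, m)),
             deg = (\<lambda>(p, q). q - p) \<rparr>"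

lemma k_graph_Omega: "k_graph (Omega :: ((nat ^ 'k) \<times> (nat ^ 'k), 'k::finite) kgraph)"
proof
  show "countable (mor (Omega :: ((nat ^ 'k) \<times> (nat ^ 'k), 'k) kgraph))"
  proof -
    have "countable (PiE (UNIV :: 'k set) (\<lambda>_. UNIV :: nat set))"
      by (rule countable_PiE) auto
    hence "countable (range (vec_lambda :: ('k \<Rightarrow> nat) \<Rightarrow> nat ^ 'k))"
      by (simp add: PiE_UNIV_domain)
    hence "countable (UNIV :: (nat ^ 'k) set)"
      by (rule countable_subset[rotated]) (metis subsetI rangeI vec_nth_inverse)
    hence "countable (UNIV :: ((nat ^ 'k) \<times> (nat ^ 'k)) set)"
      by (metis countable_SIGMA UNIV_Times_UNIV)
    thus ?thesis by (rule countable_subset[rotated]) simp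
  qed
next
  fix \<kappa> :: "(nat ^ 'k) \<times> (nat ^ 'k)" and m n :: "nat ^ 'k"
  assume "\<kappa> \<in> mor Omega" "deg Omega \<kappa> = m + n"
  then obtain p q where \<kappa>: "\<kappa> = (p, q)" "p \<le> q" "q - p = m + n"
    by (auto simp: Omega_def)
  have q: "q = p + m + n"
  proof (subst Finite_Cartesian_Product.vec_eq_iff, rule allI)
    fix i
    have "vec_nth p i \<le> vec_nth q i"
      using \<kappa>(2) by (simp add: Finite_Cartesian_Product.less_eq_vec_def)
    moreover have "vec_nth (q - p) i = vec_nth (m + n) i"
      using \<kappa>(3) by simp
    ultimately show "vec_nth q i = vec_nth (p + m + n) i"
      by simp
  qed
  show "\<exists>!(\<mu>, \<nu>). \<mu> \<in> mor Omega \<and> \<nu> \<in> mor Omega \<and> src Omega \<mu> = rng Omega \<nu> \<and>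
      \<kappa> = cmp Omega \<mu> \<nu> \<and> deg Omega \<mu> = m \<and> deg Omega \<nu> = n"
  proof (rule ex1I[of _ "((p, p + m), (p + m, q))"])
    show "case ((p, p + m), (p + m, q)) of (\<mu>, \<nu>) \<Rightarrow> \<mu> \<in> mor Omega \<and> \<nu> \<in> mor Omega \<and>
        src Omega \<mu> = rng Omega \<nu> \<and> \<kappa> = cmp Omega \<mu> \<nu> \<and> deg Omega \<mu> = m \<and> deg Omega \<nu> = n"
      by (auto simp: Omega_def \<kappa>(1) q Finite_Cartesian_Product.vec_eq_iff Finite_Cartesian_Product.less_eq_vec_def)
  next
    fix z
    assume "case z of (\<mu>, \<nu>) \<Rightarrow> \<mu> \<in> mor Omega \<and> \<nu> \<in> mor Omega \<and>
        src Omega \<mu> = rng Omega \<nu> \<and> \<kappa> = cmp Omega \<mu> \<nu> \<and> deg Omega \<mu> = m \<and> deg Omega \<nu> = n"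
    then obtain t where t: "z = ((p, t), (t, q))" "p \<le> t" "t - p = m"
      by (auto simp: Omega_def \<kappa>(1))
    have "t = p + m"
    proof (subst Finite_Cartesian_Product.vec_eq_iff, rule allI)
      fix i
      have "vec_nth p i \<le> vec_nth t i"
        using t(2) by (simp add: Finite_Cartesian_Product.less_eq_vec_def)
      moreover have "vec_nth (t - p) i = vec_nth m i"
        using t(3) by simp
      ultimately show "vec_nth t i = vec_nth (p + m) i"
        by simp
    qed
    with t show "z = ((p, p + m), (p + m, q))" by simp
  qed
qed (auto simp: Omega_def Finite_Cartesian_Product.vec_eq_iff Finite_Cartesian_Product.less_eq_vec_def intro: order_trans)

text \<open>Infinite paths are made extensional (\<open>undefined\<close> outside \<open>\<Omega>\<^sub>k\<close>), so that two of them are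
  equal as HOL functions iff they agree on \<open>\<Omega>\<^sub>k\<close>.\<close>

definition infinite_paths ::
    "('a, 'k::finite) kgraph \<Rightarrow> ((nat ^ 'k) \<times> (nat ^ 'k) \<Rightarrow> 'a) set" where
  "infinite_paths \<Lambda> = {x \<in> extensional (mor Omega). kgraph_morphism Omega \<Lambda> x}"

definition cylinder ::
    "('a, 'k::finite) kgraph \<Rightarrow> 'a \<Rightarrow> ((nat ^ 'k) \<times> (nat ^ 'k) \<Rightarrow> 'a) set" where
  "cylinder \<Lambda> \<mu> = {x \<in> infinite_paths \<Lambda>. x (0, deg \<Lambda> \<mu>) = \<mu>}"

definition path_topology ::
    "('a, 'k::finite) kgraph \<Rightarrow> ((nat ^ 'k) \<times> (nat ^ 'k) \<Rightarrow> 'a) topology" where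
  "path_topology \<Lambda> = topology_generated_by (cylinder \<Lambda> ` mor \<Lambda>)"

text \<open>Translation preserves extensionality, as \<open>m \<le> n\<close> iff \<open>m + p \<le> n + p\<close>.\<close>

definition path_shift ::
    "nat ^ 'k \<Rightarrow> ((nat ^ 'k) \<times> (nat ^ 'k) \<Rightarrow> 'a) \<Rightarrow> (nat ^ 'k) \<times> (nat ^ 'k::finite) \<Rightarrow> 'a" where
  "path_shift p x = (\<lambda>(m, n). x (m + p, n + p))"

definition prefixing ::
    "('a, 'k::finite) kgraph \<Rightarrow> 'a \<Rightarrow> ((nat ^ 'k) \<times> (nat ^ 'k) \<Rightarrow> 'a)
      \<Rightarrow> (nat ^ 'k) \<times> (nat ^ 'k) \<Rightarrow> 'a" where
  "prefixing \<Lambda> \<mu> x = (THE y. y \<in> cylinder \<Lambda> \<mu> \<and> path_shift (deg \<Lambda> \<mu>) y = x)"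

text \<open>The library's spectral radius is about matrices indexed by initial segments of the natural
  numbers.  For finite \<open>V\<close>, \<open>from_nat_into V\<close> is a bijection from \<open>{..<card V}\<close> onto \<open>V\<close>.\<close>

definition rho :: "('a, 'k::finite) kgraph \<Rightarrow> 'k \<Rightarrow> real" where
  "rho \<Lambda> i =
     (let V = vertices \<Lambda>; n = card V; e = from_nat_into V
      in spectral_radius (Matrix.mat n n (\<lambda>(p, q). of_nat (vertex_matrix \<Lambda> i (e p) (e q)))))"

definition rho_pow :: "('a, 'k::finite) kgraph \<Rightarrow> nat ^ 'k \<Rightarrow> real" where
  "rho_pow \<Lambda> n = (\<Prod>i\<in>UNIV. rho \<Lambda> i ^ vec_nth n i)"

definition pf_vector :: "('a, 'k::finite) kgraph \<Rightarrow> ('a \<Rightarrow> real) \<Rightarrow> bool" where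
  "pf_vector \<Lambda> \<xi> \<longleftrightarrow>
     (\<forall>v\<in>vertices \<Lambda>. \<xi> v > 0) \<and> (\<Sum>v\<in>vertices \<Lambda>. \<bar>\<xi> v\<bar>) = 1 \<and>
     (\<forall>i. \<forall>v\<in>vertices \<Lambda>.
        (\<Sum>w\<in>vertices \<Lambda>. real (vertex_matrix \<Lambda> i v w) * \<xi> w) = rho \<Lambda> i * \<xi> v)"

definition pf_measure ::
    "('a, 'k::finite) kgraph \<Rightarrow> ((nat ^ 'k) \<times> (nat ^ 'k) \<Rightarrow> 'a) measure \<Rightarrow> bool" where
  "pf_measure \<Lambda> M \<longleftrightarrow>
     prob_space M \<and> space M = infinite_paths \<Lambda> \<and>
     sets M = sigma_sets (infinite_paths \<Lambda>) {U. openin (path_topology \<Lambda>) U} \<and>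
     (\<exists>\<xi>. pf_vector \<Lambda> \<xi> \<and>
        (\<forall>\<mu>\<in>mor \<Lambda>. measure M (cylinder \<Lambda> \<mu>) = inverse (rho_pow \<Lambda> (deg \<Lambda> \<mu>)) * \<xi> (src \<Lambda> \<mu>)))"

text \<open>\<open>\<Phi>\<close> is a Radon-Nikodym derivative on \<open>D\<close> of \<open>\<mu> \<circ> \<sigma>\<close>, that is, of \<open>E \<mapsto> \<mu>(\<sigma>(E))\<close> for
  measurable \<open>E \<subseteq> D\<close>.  The images must be measurable for this set function to make sense.\<close>

definition rn_derivative_comp ::
    "'x measure \<Rightarrow> 'x set \<Rightarrow> ('x \<Rightarrow> 'x) \<Rightarrow> ('x \<Rightarrow> real) \<Rightarrow> bool" where
  "rn_derivative_comp M D \<sigma> \<Phi> \<longleftrightarrow>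
     \<Phi> \<in> borel_measurable M \<and>
     (\<forall>E\<in>sets M. E \<subseteq> D \<longrightarrow>
        \<sigma> ` E \<in> sets M \<and> emeasure M (\<sigma> ` E) = (\<integral>\<^sup>+x\<in>E. ennreal (\<Phi> x) \<partial>M))"

text \<open>Measure-zero conditions are stated with \<open>null_sets\<close>, since \<open>emeasure\<close> is \<open>0\<close> on every
  non-measurable set.\<close>

definition semibranching_function_system ::
    "'x measure \<Rightarrow> 'i set \<Rightarrow> ('i \<Rightarrow> 'x set) \<Rightarrow> ('i \<Rightarrow> 'x \<Rightarrow> 'x) \<Rightarrow> bool" where
  "semibranching_function_system M I D \<sigma> \<longleftrightarrow>
     finite I \<and>
     (\<forall>i\<in>I. D i \<in> sets M \<and> \<sigma> i \<in> restrict_space M (D i) \<rightarrow>\<^sub>M M) \<and>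
     space M - (\<Union>i\<in>I. \<sigma> i ` D i) \<in> null_sets M \<and>
     (\<forall>i\<in>I. \<forall>j\<in>I. i \<noteq> j \<longrightarrow> \<sigma> i ` D i \<inter> \<sigma> j ` D j \<in> null_sets M) \<and>
     (\<forall>i\<in>I. \<exists>\<Phi>. rn_derivative_comp M (D i) (\<sigma> i) \<Phi> \<and> (AE x in M. x \<in> D i \<longrightarrow> \<Phi> x > 0))"

definition coding_map ::
    "'x measure \<Rightarrow> 'i set \<Rightarrow> ('i \<Rightarrow> 'x set) \<Rightarrow> ('i \<Rightarrow> 'x \<Rightarrow> 'x) \<Rightarrow> ('x \<Rightarrow> 'x) \<Rightarrow> bool" where
  "coding_map M I D \<sigma> \<tau> \<longleftrightarrow> \<tau> \<in> M \<rightarrow>\<^sub>M M \<and> (\<forall>i\<in>I. \<forall>x\<in>D i. \<tau> (\<sigma> i x) = x)"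

text \<open>The third conjunct reads \<open>\<tau>\<^sub>\<mu> \<tau>\<^sub>\<nu> = \<tau>\<^sub>\<mu>\<^sub>\<nu>\<close> a.e. as an equality of partial functions: up to a
  null set the two sides have the same domain, and they agree there.\<close>

definition Lambda_semibranching_function_system ::
    "('a, 'k::finite) kgraph \<Rightarrow> 'x measure \<Rightarrow> ('a \<Rightarrow> 'x set) \<Rightarrow> ('a \<Rightarrow> 'x \<Rightarrow> 'x)
      \<Rightarrow> (nat ^ 'k \<Rightarrow> 'x \<Rightarrow> 'x) \<Rightarrow> bool" where
  "Lambda_semibranching_function_system \<Lambda> M D \<tau> cod \<longleftrightarrow>
     (\<forall>m. semibranching_function_system M (paths \<Lambda> m) D \<tau> \<and>
          coding_map M (paths \<Lambda> m) D \<tau> (cod m)) \<and>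
     (\<forall>v\<in>vertices \<Lambda>. (\<forall>x\<in>D v. \<tau> v x = x) \<and> emeasure M (D v) > 0) \<and>
     (\<forall>\<mu>\<in>mor \<Lambda>. \<forall>\<nu>\<in>mor \<Lambda>. src \<Lambda> \<mu> = rng \<Lambda> \<nu> \<longrightarrow>
        \<tau> \<nu> ` D \<nu> - D \<mu> \<in> null_sets M \<and>
        (AE x in M. (x \<in> D \<nu> \<and> \<tau> \<nu> x \<in> D \<mu> \<longleftrightarrow> x \<in> D (cmp \<Lambda> \<mu> \<nu>)) \<and>
           (x \<in> D (cmp \<Lambda> \<mu> \<nu>) \<longrightarrow> \<tau> \<mu> (\<tau> \<nu> x) = \<tau> (cmp \<Lambda> \<mu> \<nu>) x))) \<and>
     (\<forall>m n. \<forall>x\<in>space M. cod m (cod n x) = cod (m + n) x)"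

end

theory Submission
  imports Defs
begin

text \<open>
  The path \<open>\<lambda>x\<close> is assembled from its initial segments \<open>\<lambda> x(0, n)\<close>, whose factors of degree
  \<open>q - p\<close> do not depend on \<open>n\<close> once \<open>n\<close> is large.  As \<open>\<sigma>\<^sub>\<lambda>\<close> inverts the shift on \<open>Z(\<lambda>)\<close>, one has
  \<open>\<sigma>\<^sub>\<lambda>(E) = Z(\<lambda>) \<inter> (\<sigma>\<^sup>d)\<^sup>-\<^sup>1(E)\<close> for \<open>d = d(\<lambda>)\<close>, so images are measurable and both sides of
  \<open>M(\<sigma>\<^sub>\<lambda>(E)) = \<rho>(\<Lambda>)\<^sup>-\<^sup>d M(E)\<close> are measures in \<open>E\<close>.  They agree on cylinders because
  \<open>\<sigma>\<^sub>\<lambda>(Z(\<nu>)) = Z(\<lambda>\<nu>)\<close>; the Radon-Nikodym derivative is therefore the constant \<open>\<rho>(\<Lambda>)\<^sup>-\<^sup>d\<close>.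
\<close>

section \<open>Componentwise order and truncated subtraction on \<open>nat ^ 'k\<close>\<close>

lemma nat_vec_add_diff:
  fixes p q :: "nat ^ 'k::finite"
  assumes "p \<le> q"
  shows "p + (q - p) = q"
  using assms by (auto simp: Finite_Cartesian_Product.vec_eq_iff Finite_Cartesian_Product.less_eq_vec_def)

lemma nat_vec_le_add [simp]:
  fixes p q :: "nat ^ 'k::finite"
  shows "p \<le> p + q" "q \<le> p + q" "0 \<le> p"
  by (auto simp: Finite_Cartesian_Product.vec_eq_iff Finite_Cartesian_Product.less_eq_vec_def)

lemma nat_vec_add_le_cancel [simp]:
  fixes p q r :: "nat ^ 'k::finite"
  shows "p + r \<le> q + r \<longleftrightarrow> p \<le> q" "r + p \<le> r + q \<longleftrightarrow> p \<le> q"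
  by (auto simp: Finite_Cartesian_Product.less_eq_vec_def)

lemma nat_vec_diff_cancel [simp]:
  fixes p q r :: "nat ^ 'k::finite"
  shows "q + r - (p + r) = q - p" "r + q - (r + p) = q - p" "q - 0 = q"
  by (auto simp: Finite_Cartesian_Product.vec_eq_iff)

lemma nat_vec_diff_add_diff:
  fixes p q r :: "nat ^ 'k::finite"
  assumes "p \<le> q" "q \<le> r"
  shows "(q - p) + (r - q) = r - p"
  using assms by (auto simp: Finite_Cartesian_Product.vec_eq_iff Finite_Cartesian_Product.less_eq_vec_def)

text \<open>Multiples of (1, ..., 1) are cofinal among degrees; this lets the diagonal cylinders
  generate all the others.\<close>

lemma nat_vec_le_const_Max:
  fixes p :: "nat ^ 'k::finite"
  shows "p \<le> (\<chi> i. Max (range (vec_nth p)))"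
  by (simp add: Finite_Cartesian_Product.less_eq_vec_def)

section \<open>Infinite paths and the shift\<close>

lemma infinite_paths_iff:
  "x \<in> infinite_paths \<Lambda> \<longleftrightarrow> x \<in> extensional {(p, q). p \<le> q} \<and>
     (\<forall>p q. p \<le> q \<longrightarrow> x (p, q) \<in> mor \<Lambda> \<and> rng \<Lambda> (x (p, q)) = x (p, p) \<and>
        src \<Lambda> (x (p, q)) = x (q, q) \<and> deg \<Lambda> (x (p, q)) = q - p) \<and>
     (\<forall>p q r. p \<le> q \<longrightarrow> q \<le> r \<longrightarrow> x (p, r) = cmp \<Lambda> (x (p, q)) (x (q, r)))"
  by (auto simp: infinite_paths_def kgraph_morphism_def Omega_def)

lemma infinite_pathsD:
  assumes "x \<in> infinite_paths \<Lambda>" "p \<le> q"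
  shows "x (p, q) \<in> mor \<Lambda>" "rng \<Lambda> (x (p, q)) = x (p, p)" "src \<Lambda> (x (p, q)) = x (q, q)"
    "deg \<Lambda> (x (p, q)) = q - p"
  using assms unfolding infinite_paths_iff by blast+

lemma infinite_paths_cmp:
  assumes "x \<in> infinite_paths \<Lambda>" "p \<le> q" "q \<le> r"
  shows "x (p, r) = cmp \<Lambda> (x (p, q)) (x (q, r))"
  using assms unfolding infinite_paths_iff by blast

lemma infinite_paths_eqI:
  assumes "x \<in> infinite_paths \<Lambda>" "y \<in> infinite_paths \<Lambda>"
    and "\<And>p q. p \<le> q \<Longrightarrow> x (p, q) = y (p, q)"
  shows "x = y"
  by (rule extensionalityI[of _ "{(p, q). p \<le> q}"]) (use assms in \<open>auto simp: infinite_paths_def Omega_def\<close>)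

lemma path_shift_0 [simp]: "path_shift 0 x = x"
  by (simp add: path_shift_def)

lemma path_shift_apply [simp]: "path_shift p x (m, n) = x (m + p, n + p)"
  by (simp add: path_shift_def)

lemma path_shift_path_shift: "path_shift m (path_shift n x) = path_shift (m + n) x"
  by (auto simp: path_shift_def add.assoc)

lemma path_shift_infinite_paths:
  assumes "x \<in> infinite_paths \<Lambda>"
  shows "path_shift m x \<in> infinite_paths \<Lambda>"
  unfolding infinite_paths_iff path_shift_apply
proof (intro conjI allI impI)
  show "path_shift m x \<in> extensional {(p, q). p \<le> q}"
    using assms by (auto simp: infinite_paths_def Omega_def extensional_def path_shift_def)
  fix p q :: "nat ^ 'a"
  assume "p \<le> q"
  then have pq: "p + m \<le> q + m" by simp
  show "x (p + m, q + m) \<in> mor \<Lambda>" "rng \<Lambda> (x (p + m, q + m)) = x (p + m, p + m)"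
    "src \<Lambda> (x (p + m, q + m)) = x (q + m, q + m)"
    by (rule infinite_pathsD[OF assms pq])+
  show "deg \<Lambda> (x (p + m, q + m)) = q - p"
    using infinite_pathsD(4)[OF assms pq] by simp
  fix r
  assume "q \<le> r"
  then show "x (p + m, r + m) = cmp \<Lambda> (x (p + m, q + m)) (x (q + m, r + m))"
    by (intro infinite_paths_cmp[OF assms pq]) simp
qed

section \<open>Segments of finite paths\<close>

text \<open>This is the factor usually written \<kappa>(p, q), meaningful for p \<le> q \<le>
  d(\<kappa>). The degree of \<open>\<eta>\<close> is then forced by additivity of the
  degree.\<close>

definition segment :: "('a, 'k::finite) kgraph \<Rightarrow> 'a \<Rightarrow> nat ^ 'k \<Rightarrow> nat ^ 'k \<Rightarrow> 'a" where
  "segment \<Lambda> \<kappa> p q = (THE \<nu>. \<exists>\<mu>\<in>mor \<Lambda>. \<exists>\<eta>\<in>mor \<Lambda>. \<nu> \<in> mor \<Lambda> \<and> src \<Lambda> \<mu> = rng \<Lambda> \<nu> \<and>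
     src \<Lambda> \<nu> = rng \<Lambda> \<eta> \<and> \<kappa> = cmp \<Lambda> \<mu> (cmp \<Lambda> \<nu> \<eta>) \<and> deg \<Lambda> \<mu> = p \<and> deg \<Lambda> \<nu> = q - p)"

context k_graph
begin

text \<open>The uniqueness half of factorization as a cancellation rule: once the first degrees
  agree, the second ones agree by cancellation in \<open>nat ^ 'k\<close>.\<close>

lemma cmp_eq_cmpD:
  assumes "\<mu> \<in> mor \<Lambda>" "\<nu> \<in> mor \<Lambda>" "src \<Lambda> \<mu> = rng \<Lambda> \<nu>"
    and "\<mu>' \<in> mor \<Lambda>" "\<nu>' \<in> mor \<Lambda>" "src \<Lambda> \<mu>' = rng \<Lambda> \<nu>'"
    and "cmp \<Lambda> \<mu> \<nu> = cmp \<Lambda> \<mu>' \<nu>'" "deg \<Lambda> \<mu> = deg \<Lambda> \<mu>'"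
  shows "\<mu> = \<mu>' \<and> \<nu> = \<nu>'"
proof -
  have "deg \<Lambda> \<mu> + deg \<Lambda> \<nu> = deg \<Lambda> \<mu>' + deg \<Lambda> \<nu>'"
    using assms by (metis deg_cmp)
  hence "deg \<Lambda> \<nu> = deg \<Lambda> \<nu>'"
    using assms by simp
  have "\<exists>!(\<alpha>, \<beta>). \<alpha> \<in> mor \<Lambda> \<and> \<beta> \<in> mor \<Lambda> \<and> src \<Lambda> \<alpha> = rng \<Lambda> \<beta> \<and>
      cmp \<Lambda> \<mu> \<nu> = cmp \<Lambda> \<alpha> \<beta> \<and> deg \<Lambda> \<alpha> = deg \<Lambda> \<mu> \<and> deg \<Lambda> \<beta> = deg \<Lambda> \<nu>"
    using assms by (intro factorization cmp_mor deg_cmp) auto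
  then obtain z where z: "\<forall>y. (case y of (\<alpha>, \<beta>) \<Rightarrow> \<alpha> \<in> mor \<Lambda> \<and> \<beta> \<in> mor \<Lambda> \<and> src \<Lambda> \<alpha> = rng \<Lambda> \<beta> \<and>
      cmp \<Lambda> \<mu> \<nu> = cmp \<Lambda> \<alpha> \<beta> \<and> deg \<Lambda> \<alpha> = deg \<Lambda> \<mu> \<and> deg \<Lambda> \<beta> = deg \<Lambda> \<nu>) \<longrightarrow> y = z"
    by (elim ex1E) blast
  have "(\<mu>, \<nu>) = z" "(\<mu>', \<nu>') = z"
    using spec[OF z, of "(\<mu>, \<nu>)"] spec[OF z, of "(\<mu>', \<nu>')"] assms \<open>deg \<Lambda> \<nu> = deg \<Lambda> \<nu>'\<close> by auto
  thus ?thesis by blast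
qed

lemma factorE:
  assumes "\<kappa> \<in> mor \<Lambda>" "p \<le> deg \<Lambda> \<kappa>"
  obtains \<mu> \<nu> where "\<mu> \<in> mor \<Lambda>" "\<nu> \<in> mor \<Lambda>" "src \<Lambda> \<mu> = rng \<Lambda> \<nu>" "\<kappa> = cmp \<Lambda> \<mu> \<nu>"
    "deg \<Lambda> \<mu> = p" "deg \<Lambda> \<nu> = deg \<Lambda> \<kappa> - p"
  using factorization[OF assms(1), of p "deg \<Lambda> \<kappa> - p"] nat_vec_add_diff[OF assms(2)]
  by (auto split: prod.splits)

text \<open>Unique factorization is applied twice, first to split off \<open>\<mu>\<close> and then
  to separate \<open>\<nu>\<close> from \<open>\<eta>\<close>.\<close>

lemma segment_cmp:
  assumes "\<mu> \<in> mor \<Lambda>" "\<nu> \<in> mor \<Lambda>" "\<eta> \<in> mor \<Lambda>" "src \<Lambda> \<mu> = rng \<Lambda> \<nu>" "src \<Lambda> \<nu> = rng \<Lambda> \<eta>"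
    and "deg \<Lambda> \<mu> = p" "deg \<Lambda> \<nu> = q - p"
  shows "segment \<Lambda> (cmp \<Lambda> \<mu> (cmp \<Lambda> \<nu> \<eta>)) p q = \<nu>"
  unfolding segment_def
proof (rule the_equality)
  fix \<nu>' assume "\<exists>\<mu>'\<in>mor \<Lambda>. \<exists>\<eta>'\<in>mor \<Lambda>. \<nu>' \<in> mor \<Lambda> \<and> src \<Lambda> \<mu>' = rng \<Lambda> \<nu>' \<and>
     src \<Lambda> \<nu>' = rng \<Lambda> \<eta>' \<and> cmp \<Lambda> \<mu> (cmp \<Lambda> \<nu> \<eta>) = cmp \<Lambda> \<mu>' (cmp \<Lambda> \<nu>' \<eta>') \<and>
     deg \<Lambda> \<mu>' = p \<and> deg \<Lambda> \<nu>' = q - p"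
  then obtain \<mu>' \<eta>' where *: "\<mu>' \<in> mor \<Lambda>" "\<eta>' \<in> mor \<Lambda>" "\<nu>' \<in> mor \<Lambda>" "src \<Lambda> \<mu>' = rng \<Lambda> \<nu>'"
     "src \<Lambda> \<nu>' = rng \<Lambda> \<eta>'" "cmp \<Lambda> \<mu> (cmp \<Lambda> \<nu> \<eta>) = cmp \<Lambda> \<mu>' (cmp \<Lambda> \<nu>' \<eta>')"
     "deg \<Lambda> \<mu>' = p" "deg \<Lambda> \<nu>' = q - p"
    by blast
  have "cmp \<Lambda> \<nu> \<eta> = cmp \<Lambda> \<nu>' \<eta>'"
    using cmp_eq_cmpD[of \<mu> "cmp \<Lambda> \<nu> \<eta>" \<mu>' "cmp \<Lambda> \<nu>' \<eta>'"] * assms by (simp add: cmp_mor rng_cmp)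
  thus "\<nu>' = \<nu>"
    using cmp_eq_cmpD[of \<nu> \<eta> \<nu>' \<eta>'] * assms by simp
qed (use assms in blast)

lemma segmentE:
  assumes "\<kappa> \<in> mor \<Lambda>" "p \<le> q" "q \<le> deg \<Lambda> \<kappa>"
  obtains \<mu> \<eta> where "\<mu> \<in> mor \<Lambda>" "\<eta> \<in> mor \<Lambda>" "segment \<Lambda> \<kappa> p q \<in> mor \<Lambda>"
    "src \<Lambda> \<mu> = rng \<Lambda> (segment \<Lambda> \<kappa> p q)" "src \<Lambda> (segment \<Lambda> \<kappa> p q) = rng \<Lambda> \<eta>"
    "\<kappa> = cmp \<Lambda> \<mu> (cmp \<Lambda> (segment \<Lambda> \<kappa> p q) \<eta>)" "deg \<Lambda> \<mu> = p" "deg \<Lambda> (segment \<Lambda> \<kappa> p q) = q - p"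
proof -
  obtain \<alpha> \<eta> where 1: "\<alpha> \<in> mor \<Lambda>" "\<eta> \<in> mor \<Lambda>" "src \<Lambda> \<alpha> = rng \<Lambda> \<eta>" "\<kappa> = cmp \<Lambda> \<alpha> \<eta>" "deg \<Lambda> \<alpha> = q"
    using factorE assms(1,3) by metis
  obtain \<mu> \<nu> where 2: "\<mu> \<in> mor \<Lambda>" "\<nu> \<in> mor \<Lambda>" "src \<Lambda> \<mu> = rng \<Lambda> \<nu>" "\<alpha> = cmp \<Lambda> \<mu> \<nu>"
     "deg \<Lambda> \<mu> = p" "deg \<Lambda> \<nu> = q - p"
    using factorE[of \<alpha> p] 1 assms(2) by metis
  have 3: "src \<Lambda> \<nu> = rng \<Lambda> \<eta>" "\<kappa> = cmp \<Lambda> \<mu> (cmp \<Lambda> \<nu> \<eta>)"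
    using 1 2 by (simp_all add: src_cmp cmp_assoc)
  have "segment \<Lambda> \<kappa> p q = \<nu>"
    using segment_cmp[of \<mu> \<nu> \<eta>] 1 2 3 by simp
  thus ?thesis using that 1 2 3 by metis
qed

text \<open>Composing on the right only lengthens the last of the three factors. This is the
  stability that allows an infinite path to be read off from a growing chain of finite ones.\<close>

lemma segment_extend:
  assumes "\<kappa> \<in> mor \<Lambda>" "\<eta> \<in> mor \<Lambda>" "src \<Lambda> \<kappa> = rng \<Lambda> \<eta>" "p \<le> q" "q \<le> deg \<Lambda> \<kappa>"
  shows "segment \<Lambda> (cmp \<Lambda> \<kappa> \<eta>) p q = segment \<Lambda> \<kappa> p q"
proof -
  define \<nu> where "\<nu> = segment \<Lambda> \<kappa> p q"
  obtain \<mu> \<eta>' where *: "\<mu> \<in> mor \<Lambda>" "\<eta>' \<in> mor \<Lambda>" "\<nu> \<in> mor \<Lambda>"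
    "src \<Lambda> \<mu> = rng \<Lambda> \<nu>" "src \<Lambda> \<nu> = rng \<Lambda> \<eta>'"
    "\<kappa> = cmp \<Lambda> \<mu> (cmp \<Lambda> \<nu> \<eta>')" "deg \<Lambda> \<mu> = p" "deg \<Lambda> \<nu> = q - p"
    using segmentE[OF assms(1,4,5)] unfolding \<nu>_def by metis
  have "src \<Lambda> \<eta>' = rng \<Lambda> \<eta>"
    using * assms by (simp add: src_cmp rng_cmp cmp_mor)
  then have "segment \<Lambda> (cmp \<Lambda> \<mu> (cmp \<Lambda> \<nu> (cmp \<Lambda> \<eta>' \<eta>))) p q = \<nu>"
    using * assms by (intro segment_cmp) (simp_all add: cmp_mor rng_cmp)
  moreover have "cmp \<Lambda> \<mu> (cmp \<Lambda> \<nu> (cmp \<Lambda> \<eta>' \<eta>)) = cmp \<Lambda> \<kappa> \<eta>"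
    using * assms \<open>src \<Lambda> \<eta>' = rng \<Lambda> \<eta>\<close> by (simp add: cmp_assoc cmp_mor rng_cmp src_cmp)
  ultimately show ?thesis
    by (simp add: \<nu>_def)
qed

lemma segment_segment:
  assumes "\<kappa> \<in> mor \<Lambda>" "p \<le> q" "q \<le> r" "r \<le> deg \<Lambda> \<kappa>"
  shows "src \<Lambda> (segment \<Lambda> \<kappa> p q) = rng \<Lambda> (segment \<Lambda> \<kappa> q r)"
    and "segment \<Lambda> \<kappa> p r = cmp \<Lambda> (segment \<Lambda> \<kappa> p q) (segment \<Lambda> \<kappa> q r)"
proof -
  define \<alpha> where "\<alpha> = segment \<Lambda> \<kappa> p r"
  obtain \<mu> \<eta> where *: "\<mu> \<in> mor \<Lambda>" "\<eta> \<in> mor \<Lambda>" "\<alpha> \<in> mor \<Lambda>"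
    "src \<Lambda> \<mu> = rng \<Lambda> \<alpha>" "src \<Lambda> \<alpha> = rng \<Lambda> \<eta>"
    "\<kappa> = cmp \<Lambda> \<mu> (cmp \<Lambda> \<alpha> \<eta>)" "deg \<Lambda> \<mu> = p" "deg \<Lambda> \<alpha> = r - p"
    using segmentE[of \<kappa> p r] order_trans[OF assms(2,3)] assms(1,4) unfolding \<alpha>_def by metis
  have "q - p \<le> deg \<Lambda> \<alpha>"
    using nat_vec_diff_add_diff[OF assms(2,3)] *(8) by (metis nat_vec_le_add(1))
  then obtain \<nu> \<nu>' where **: "\<nu> \<in> mor \<Lambda>" "\<nu>' \<in> mor \<Lambda>" "src \<Lambda> \<nu> = rng \<Lambda> \<nu>'" "\<alpha> = cmp \<Lambda> \<nu> \<nu>'"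
     "deg \<Lambda> \<nu> = q - p" "deg \<Lambda> \<nu>' = deg \<Lambda> \<alpha> - (q - p)"
    using factorE[OF *(3)] by metis
  have d: "deg \<Lambda> \<nu>' = r - q"
    unfolding **(6) *(8) nat_vec_diff_add_diff[OF assms(2,3), symmetric] by simp
  \<comment> \<open>Cutting \<kappa>(p, r) at degree q - p gives four factors of
    \<open>\<kappa>\<close>; grouping the last two exhibits \<kappa>(p, q), grouping the first two
    exhibits \<kappa>(q, r).\<close>
  have 1: "segment \<Lambda> (cmp \<Lambda> \<mu> (cmp \<Lambda> \<nu> (cmp \<Lambda> \<nu>' \<eta>))) p q = \<nu>"
    using * **(1-5) by (intro segment_cmp) (simp_all add: cmp_mor rng_cmp src_cmp)
  have 2: "segment \<Lambda> (cmp \<Lambda> (cmp \<Lambda> \<mu> \<nu>) (cmp \<Lambda> \<nu>' \<eta>)) q r = \<nu>'"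
    using * **(1-5) d by (intro segment_cmp)
      (simp_all add: cmp_mor rng_cmp src_cmp deg_cmp nat_vec_add_diff[OF assms(2)])
  have \<kappa>: "\<kappa> = cmp \<Lambda> \<mu> (cmp \<Lambda> \<nu> (cmp \<Lambda> \<nu>' \<eta>))" "\<kappa> = cmp \<Lambda> (cmp \<Lambda> \<mu> \<nu>) (cmp \<Lambda> \<nu>' \<eta>)"
    using * **(1-5) by (simp_all add: cmp_assoc cmp_mor rng_cmp src_cmp)
  show "src \<Lambda> (segment \<Lambda> \<kappa> p q) = rng \<Lambda> (segment \<Lambda> \<kappa> q r)"
    using 1 2 **(3) by (simp add: \<kappa>(1)[symmetric] \<kappa>(2)[symmetric])
  show "segment \<Lambda> \<kappa> p r = cmp \<Lambda> (segment \<Lambda> \<kappa> p q) (segment \<Lambda> \<kappa> q r)"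
    using 1 2 **(4) by (simp add: \<kappa>(1)[symmetric] \<kappa>(2)[symmetric] \<alpha>_def)
qed

text \<open>Converse to \<open>deg_id\<close>: r(v) v and v s(v) are two factorizations of v whose
  first factors both have degree 0, so they coincide.\<close>

lemma vertex_eq:
  assumes "v \<in> mor \<Lambda>" "deg \<Lambda> v = 0"
  shows "rng \<Lambda> v = v" "src \<Lambda> v = v"
proof -
  have "deg \<Lambda> (rng \<Lambda> v) = 0"
    using assms by (intro deg_id rng_mor rng_rng)
  then show "rng \<Lambda> v = v"
    using cmp_eq_cmpD[of "rng \<Lambda> v" v v "src \<Lambda> v"] assms
    by (simp add: rng_mor src_mor src_rng rng_src rng_id src_id)
  then show "src \<Lambda> v = v"
    using assms src_rng by metis
qed

text \<open>Segments of degree 0 are vertices, and \<open>segment_segment\<close> makes them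
  composable with the adjacent segment, so they must be its endpoints.\<close>

lemma segment_refl:
  assumes "\<kappa> \<in> mor \<Lambda>" "p \<le> q" "q \<le> deg \<Lambda> \<kappa>"
  shows "segment \<Lambda> \<kappa> p p = rng \<Lambda> (segment \<Lambda> \<kappa> p q)"
    and "segment \<Lambda> \<kappa> q q = src \<Lambda> (segment \<Lambda> \<kappa> p q)"
proof -
  have v: "rng \<Lambda> (segment \<Lambda> \<kappa> r r) = segment \<Lambda> \<kappa> r r \<and> src \<Lambda> (segment \<Lambda> \<kappa> r r) = segment \<Lambda> \<kappa> r r"
    if "r \<le> deg \<Lambda> \<kappa>" for r
  proof -
    have "segment \<Lambda> \<kappa> r r \<in> mor \<Lambda>" "deg \<Lambda> (segment \<Lambda> \<kappa> r r) = 0"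
      using segmentE[OF assms(1) order_refl that] by (metis, metis cancel_comm_monoid_add_class.diff_cancel)
    thus ?thesis using vertex_eq by blast
  qed
  show "segment \<Lambda> \<kappa> p p = rng \<Lambda> (segment \<Lambda> \<kappa> p q)"
    using v[of p] segment_segment(1)[OF assms(1) order_refl assms(2,3)] order_trans[OF assms(2,3)]
    by simp
  show "segment \<Lambda> \<kappa> q q = src \<Lambda> (segment \<Lambda> \<kappa> p q)"
    using v[of q] segment_segment(1)[OF assms(1,2) order_refl assms(3)] assms(3) by simp
qed

section \<open>Existence and uniqueness of prefixed paths\<close>

text \<open>Any chain of finite paths extending one another, of cofinal degrees, defines an infinite
  path. The value \<open>undefined\<close> off p \<le> q meets the extensionality built into
  \<open>infinite_paths\<close>.\<close>

lemma infinite_path_of_chain: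
  assumes mor: "\<And>n. \<kappa> n \<in> mor \<Lambda>" and deg: "\<And>n. n \<le> deg \<Lambda> (\<kappa> n)"
    and ext: "\<And>m n. m \<le> n \<Longrightarrow> \<exists>\<eta>\<in>mor \<Lambda>. src \<Lambda> (\<kappa> m) = rng \<Lambda> \<eta> \<and> \<kappa> n = cmp \<Lambda> (\<kappa> m) \<eta>"
  shows "(\<lambda>(p, q). if p \<le> q then segment \<Lambda> (\<kappa> q) p q else undefined) \<in> infinite_paths \<Lambda>"
    (is "?x \<in> _")
proof -
  \<comment> \<open>Adjacent segments can thus be compared inside a single finite path, where
    \<open>segment_segment\<close> and \<open>segment_refl\<close> apply.\<close>
  have seg: "segment \<Lambda> (\<kappa> q) p q = segment \<Lambda> (\<kappa> r) p q" if "p \<le> q" "q \<le> r" for p q r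
    using ext[OF that(2)] segment_extend[OF mor _ _ that(1) deg] by metis
  have props: "segment \<Lambda> (\<kappa> q) p q \<in> mor \<Lambda>" "deg \<Lambda> (segment \<Lambda> (\<kappa> q) p q) = q - p"
    if "p \<le> q" for p q
    using segmentE[OF mor that deg] by metis+
  have cmp: "segment \<Lambda> (\<kappa> r) p r = cmp \<Lambda> (segment \<Lambda> (\<kappa> q) p q) (segment \<Lambda> (\<kappa> r) q r)"
    if "p \<le> q" "q \<le> r" for p q r
    unfolding seg[OF that] by (rule segment_segment(2)[OF mor that deg])
  have ends: "rng \<Lambda> (segment \<Lambda> (\<kappa> q) p q) = segment \<Lambda> (\<kappa> p) p p"
    "src \<Lambda> (segment \<Lambda> (\<kappa> q) p q) = segment \<Lambda> (\<kappa> q) q q" if "p \<le> q" for p q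
    using segment_refl[OF mor that deg] seg[OF order_refl that] by simp_all
  show ?thesis
    unfolding infinite_paths_iff
  proof (intro conjI allI impI)
    show "?x \<in> extensional {(p, q). p \<le> q}"
      by (auto simp: extensional_def)
    fix p q :: "nat ^ 'b"
    assume pq: "p \<le> q"
    show "?x (p, q) \<in> mor \<Lambda>" "rng \<Lambda> (?x (p, q)) = ?x (p, p)" "src \<Lambda> (?x (p, q)) = ?x (q, q)"
      "deg \<Lambda> (?x (p, q)) = q - p"
      using pq props[OF pq] ends[OF pq] by simp_all
    fix r
    assume qr: "q \<le> r"
    show "?x (p, r) = cmp \<Lambda> (?x (p, q)) (?x (q, r))"
      using pq qr order_trans[OF pq qr] by (simp only: split_conv if_True cmp[OF pq qr])
  qed
qed

text \<open>Both sides are factors of y(0, q + d) = \<mu> x(0, q), where d = d(\<mu>) and x is the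
  shift of y by d. Hence y is determined by \<open>\<mu>\<close> and x, and each value of y depends
  only on an initial segment of x; the first fact gives uniqueness of \<mu>x, the second
  measurability of prefixing.\<close>

lemma prefixed_segment:
  assumes y: "y \<in> cylinder \<Lambda> \<mu>" and "p \<le> q"
  shows "y (p, q) = segment \<Lambda> (cmp \<Lambda> \<mu> (path_shift (deg \<Lambda> \<mu>) y (0, q))) p q"
proof -
  let ?d = "deg \<Lambda> \<mu>"
  have yi: "y \<in> infinite_paths \<Lambda>" and y0: "y (0, ?d) = \<mu>"
    using y by (auto simp: cylinder_def)
  have qd: "q \<le> q + ?d" "0 \<le> p" "?d \<le> q + ?d" "p \<le> q + ?d"
    using assms(2) by (auto intro: order_trans[of p q])
  have "cmp \<Lambda> \<mu> (path_shift ?d y (0, q)) = y (0, q + ?d)"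
    using infinite_paths_cmp[OF yi, of 0 ?d "q + ?d"] y0 by simp
  also have "\<dots> = cmp \<Lambda> (y (0, p)) (cmp \<Lambda> (y (p, q)) (y (q, q + ?d)))"
    using infinite_paths_cmp[OF yi qd(2,4)] infinite_paths_cmp[OF yi assms(2) qd(1)] by simp
  finally show ?thesis
    using infinite_pathsD[OF yi assms(2)] infinite_pathsD[OF yi qd(1)] infinite_pathsD[OF yi qd(2)]
    by (simp add: segment_cmp)
qed

text \<open>This makes the definite description in \<open>prefixing\<close> meaningful.\<close>

lemma ex1_prefixed:
  assumes \<mu>: "\<mu> \<in> mor \<Lambda>" and x: "x \<in> cylinder \<Lambda> (src \<Lambda> \<mu>)"
  shows "\<exists>!y. y \<in> cylinder \<Lambda> \<mu> \<and> path_shift (deg \<Lambda> \<mu>) y = x"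
proof (rule ex_ex1I)
  let ?d = "deg \<Lambda> \<mu>"
  have xi: "x \<in> infinite_paths \<Lambda>" and "x (0, deg \<Lambda> (src \<Lambda> \<mu>)) = src \<Lambda> \<mu>"
    using x by (auto simp: cylinder_def)
  then have x0: "x (0, 0) = src \<Lambda> \<mu>"
    using deg_id[OF src_mor[OF \<mu>] rng_src[OF \<mu>]] by simp
  define \<kappa> where "\<kappa> n = cmp \<Lambda> \<mu> (x (0, n))" for n
  define y where "y = (\<lambda>(p, q). if p \<le> q then segment \<Lambda> (\<kappa> q) p q else undefined)"
  have xn: "x (0, n) \<in> mor \<Lambda>" "src \<Lambda> \<mu> = rng \<Lambda> (x (0, n))" "deg \<Lambda> (x (0, n)) = n" for n
    using infinite_pathsD[OF xi, of 0 n] x0 by auto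
  have mor: "\<kappa> n \<in> mor \<Lambda>" and deg: "deg \<Lambda> (\<kappa> n) = ?d + n" for n
    unfolding \<kappa>_def using \<mu> xn[of n] by (auto simp: cmp_mor deg_cmp)
  have ext: "src \<Lambda> (\<kappa> m) = rng \<Lambda> (x (m, n)) \<and> \<kappa> n = cmp \<Lambda> (\<kappa> m) (x (m, n))"
    if "m \<le> n" for m n
  proof -
    have "x (0, n) = cmp \<Lambda> (x (0, m)) (x (m, n))"
      by (rule infinite_paths_cmp[OF xi _ that]) simp
    thus ?thesis
      unfolding \<kappa>_def using infinite_pathsD[OF xi that] infinite_pathsD(3)[OF xi, of 0 m] xn[of m] \<mu>
      by (simp add: cmp_assoc src_cmp)
  qed
  have yi: "y \<in> infinite_paths \<Lambda>"
    unfolding y_def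
  proof (rule infinite_path_of_chain)
    fix m n :: "nat ^ 'b" assume "m \<le> n"
    then show "\<exists>\<eta>\<in>mor \<Lambda>. src \<Lambda> (\<kappa> m) = rng \<Lambda> \<eta> \<and> \<kappa> n = cmp \<Lambda> (\<kappa> m) \<eta>"
      using ext infinite_pathsD(1)[OF xi] by blast
  qed (simp_all add: mor deg)
  have "y (0, ?d) = segment \<Lambda> (cmp \<Lambda> \<mu> (x (0, ?d))) 0 ?d"
    by (simp add: y_def \<kappa>_def)
  also have "\<dots> = segment \<Lambda> \<mu> 0 ?d"
    using \<mu> xn[of ?d] by (intro segment_extend) auto
  \<comment> \<open>\<open>\<mu>\<close> is flanked by its own range and source to obtain the
    three-factor form that \<open>segment_cmp\<close> expects.\<close>
  also have "\<dots> = \<mu>"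
    using segment_cmp[of "rng \<Lambda> \<mu>" \<mu> "src \<Lambda> \<mu>" 0 ?d] \<mu>
    by (simp add: rng_mor src_mor src_rng rng_src rng_id src_id deg_id rng_rng)
  finally have "y \<in> cylinder \<Lambda> \<mu>"
    using yi by (simp add: cylinder_def)
  moreover have "path_shift ?d y = x"
  proof (rule infinite_paths_eqI)
    fix p q :: "nat ^ 'b" assume pq: "p \<le> q"
    have q: "q \<le> q + ?d" by simp
    \<comment> \<open>Since \<open>\<kappa> p\<close> already has degree d(\<mu>) + p, the middle
      factor x(p, q) occupies exactly the positions that the shift moves to (p, q).\<close>
    have "\<kappa> (q + ?d) = cmp \<Lambda> (\<kappa> p) (cmp \<Lambda> (x (p, q)) (x (q, q + ?d)))"
      using ext[OF order_trans[OF pq q]] infinite_paths_cmp[OF xi pq q] by simp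
    then have "segment \<Lambda> (\<kappa> (q + ?d)) (p + ?d) (q + ?d) = x (p, q)"
      using ext[OF pq] infinite_pathsD[OF xi pq] infinite_pathsD[OF xi q] mor deg
      by (simp add: segment_cmp add.commute)
    then show "path_shift ?d y (p, q) = x (p, q)"
      using pq by (simp add: y_def)
  qed (use yi xi path_shift_infinite_paths in auto)
  ultimately show "\<exists>y. y \<in> cylinder \<Lambda> \<mu> \<and> path_shift ?d y = x"
    by blast
next
  fix y y'
  assume "y \<in> cylinder \<Lambda> \<mu> \<and> path_shift (deg \<Lambda> \<mu>) y = x"
    and "y' \<in> cylinder \<Lambda> \<mu> \<and> path_shift (deg \<Lambda> \<mu>) y' = x"
  then show "y = y'"
    using prefixed_segment[of y \<mu>] prefixed_segment[of y' \<mu>]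
    by (intro infinite_paths_eqI[of y \<Lambda> y']) (auto simp: cylinder_def)
qed

lemma prefixing_works:
  assumes "\<mu> \<in> mor \<Lambda>" "x \<in> cylinder \<Lambda> (src \<Lambda> \<mu>)"
  shows "prefixing \<Lambda> \<mu> x \<in> cylinder \<Lambda> \<mu>" "path_shift (deg \<Lambda> \<mu>) (prefixing \<Lambda> \<mu> x) = x"
  using theI'[OF ex1_prefixed[OF assms]] by (auto simp: prefixing_def)

lemma prefixing_eqI:
  assumes "\<mu> \<in> mor \<Lambda>" "x \<in> cylinder \<Lambda> (src \<Lambda> \<mu>)"
    and "y \<in> cylinder \<Lambda> \<mu>" "path_shift (deg \<Lambda> \<mu>) y = x"
  shows "prefixing \<Lambda> \<mu> x = y"
  using ex1_prefixed[OF assms(1,2)] prefixing_works[OF assms(1,2)] assms(3,4) by blast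

section \<open>Cylinders under prefixing and shift\<close>

lemma cylinder_vertex:
  assumes "\<mu> \<in> mor \<Lambda>"
  shows "cylinder \<Lambda> (src \<Lambda> \<mu>) = {x \<in> infinite_paths \<Lambda>. x (0, 0) = src \<Lambda> \<mu>}"
    and "cylinder \<Lambda> (rng \<Lambda> \<mu>) = {x \<in> infinite_paths \<Lambda>. x (0, 0) = rng \<Lambda> \<mu>}"
  using assms by (simp_all add: cylinder_def deg_id src_mor rng_src rng_mor rng_rng)

lemma path_shift_cylinder:
  assumes "\<mu> \<in> mor \<Lambda>" "y \<in> cylinder \<Lambda> \<mu>"
  shows "path_shift (deg \<Lambda> \<mu>) y \<in> cylinder \<Lambda> (src \<Lambda> \<mu>)"
proof -
  have y: "y \<in> infinite_paths \<Lambda>" "y (0, deg \<Lambda> \<mu>) = \<mu>"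
    using assms(2) by (auto simp: cylinder_def)
  have "y (deg \<Lambda> \<mu>, deg \<Lambda> \<mu>) = src \<Lambda> \<mu>"
    using infinite_pathsD(3)[OF y(1), of 0 "deg \<Lambda> \<mu>"] y(2) by simp
  then show ?thesis
    unfolding cylinder_vertex(1)[OF assms(1)] using y(1) path_shift_infinite_paths by auto
qed

lemma prefixing_image:
  assumes "\<mu> \<in> mor \<Lambda>" "E \<subseteq> cylinder \<Lambda> (src \<Lambda> \<mu>)"
  shows "prefixing \<Lambda> \<mu> ` E = {y \<in> cylinder \<Lambda> \<mu>. path_shift (deg \<Lambda> \<mu>) y \<in> E}"
proof (intro equalityI subsetI)
  fix y assume "y \<in> {y \<in> cylinder \<Lambda> \<mu>. path_shift (deg \<Lambda> \<mu>) y \<in> E}"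
  then show "y \<in> prefixing \<Lambda> \<mu> ` E"
    using prefixing_eqI[OF assms(1), of _ y] assms(2) by (intro image_eqI[of _ _ "path_shift (deg \<Lambda> \<mu>) y"]) auto
qed (use assms prefixing_works[OF assms(1)] in auto)

lemma prefixing_range:
  assumes "\<mu> \<in> mor \<Lambda>"
  shows "prefixing \<Lambda> \<mu> ` cylinder \<Lambda> (src \<Lambda> \<mu>) = cylinder \<Lambda> \<mu>"
  using prefixing_image[OF assms order_refl] path_shift_cylinder[OF assms] by auto

text \<open>By unique factorization, an initial segment equals \<mu>\<nu> exactly when its two
  pieces are \<open>\<mu>\<close> and \<open>\<nu>\<close>. With \<open>prefixing_image\<close> this
  says that prefixing by \<open>\<mu>\<close> carries Z(\<nu>) onto Z(\<mu>\<nu>).\<close>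

lemma cylinder_cmp:
  assumes "\<mu> \<in> mor \<Lambda>" "\<nu> \<in> mor \<Lambda>" "src \<Lambda> \<mu> = rng \<Lambda> \<nu>"
  shows "cylinder \<Lambda> (cmp \<Lambda> \<mu> \<nu>) = {y \<in> cylinder \<Lambda> \<mu>. path_shift (deg \<Lambda> \<mu>) y \<in> cylinder \<Lambda> \<nu>}"
proof -
  let ?m = "deg \<Lambda> \<mu>" and ?n = "deg \<Lambda> \<nu>"
  have "y (0, ?m + ?n) = cmp \<Lambda> \<mu> \<nu> \<longleftrightarrow> y (0, ?m) = \<mu> \<and> y (?m, ?m + ?n) = \<nu>"
    if y: "y \<in> infinite_paths \<Lambda>" for y
  proof -
    have "y (0, ?m + ?n) = cmp \<Lambda> (y (0, ?m)) (y (?m, ?m + ?n))"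
      by (rule infinite_paths_cmp[OF y]) auto
    then show ?thesis
      using cmp_eq_cmpD[of "y (0, ?m)" "y (?m, ?m + ?n)" \<mu> \<nu>] assms
        infinite_pathsD[OF y, of 0 ?m] infinite_pathsD[OF y, of ?m "?m + ?n"] by auto
  qed
  then show ?thesis
    using assms by (auto simp: cylinder_def deg_cmp path_shift_infinite_paths add.commute)
qed

lemma cylinder_subset_rng:
  assumes "\<mu> \<in> mor \<Lambda>"
  shows "cylinder \<Lambda> \<mu> \<subseteq> cylinder \<Lambda> (rng \<Lambda> \<mu>)"
proof
  fix y assume "y \<in> cylinder \<Lambda> \<mu>"
  then have y: "y \<in> infinite_paths \<Lambda>" "y (0, deg \<Lambda> \<mu>) = \<mu>"
    by (auto simp: cylinder_def)
  show "y \<in> cylinder \<Lambda> (rng \<Lambda> \<mu>)"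
    using infinite_pathsD(2)[OF y(1), of 0 "deg \<Lambda> \<mu>"] y
    unfolding cylinder_vertex(2)[OF assms] by simp
qed

text \<open>The iterated prefix lies in Z(\<mu>\<nu>) and shifts back to x in two stages, so
  uniqueness identifies it.\<close>

lemma prefixing_cmp:
  assumes "\<mu> \<in> mor \<Lambda>" "\<nu> \<in> mor \<Lambda>" "src \<Lambda> \<mu> = rng \<Lambda> \<nu>" "x \<in> cylinder \<Lambda> (src \<Lambda> \<nu>)"
  shows "prefixing \<Lambda> \<mu> (prefixing \<Lambda> \<nu> x) = prefixing \<Lambda> (cmp \<Lambda> \<mu> \<nu>) x"
proof -
  have x: "prefixing \<Lambda> \<nu> x \<in> cylinder \<Lambda> \<nu>" "path_shift (deg \<Lambda> \<nu>) (prefixing \<Lambda> \<nu> x) = x"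
    using prefixing_works assms by auto
  then have "prefixing \<Lambda> \<nu> x \<in> cylinder \<Lambda> (src \<Lambda> \<mu>)"
    using cylinder_subset_rng assms by auto
  from prefixing_works[OF assms(1) this] x show ?thesis
    using assms by (intro prefixing_eqI[symmetric])
      (simp_all add: cylinder_cmp cmp_mor src_cmp deg_cmp add.commute[of "deg \<Lambda> \<mu>"]
        flip: path_shift_path_shift)
qed

section \<open>Cylinders as a base of the topology and generators of the Borel sets\<close>

text \<open>Two paths with the same initial segment of degree n share that of degree m, by
  uniqueness of its factorization at m.\<close>

lemma cylinder_antimono:
  assumes x: "x \<in> infinite_paths \<Lambda>" and "m \<le> n"
  shows "cylinder \<Lambda> (x (0, n)) \<subseteq> cylinder \<Lambda> (x (0, m))"
proof
  fix y assume "y \<in> cylinder \<Lambda> (x (0, n))"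
  then have y: "y \<in> infinite_paths \<Lambda>" "y (0, n) = x (0, n)"
    using infinite_pathsD(4)[OF x, of 0 n] by (auto simp: cylinder_def)
  have "y (0, n) = cmp \<Lambda> (y (0, m)) (y (m, n))" "x (0, n) = cmp \<Lambda> (x (0, m)) (x (m, n))"
    using infinite_paths_cmp[OF _ _ assms(2), of _ \<Lambda> 0] x y(1) by (metis nat_vec_le_add(3))+
  then have "cmp \<Lambda> (y (0, m)) (y (m, n)) = cmp \<Lambda> (x (0, m)) (x (m, n))"
    using y(2) by simp
  moreover have "z (0, m) \<in> mor \<Lambda>" "z (m, n) \<in> mor \<Lambda>" "src \<Lambda> (z (0, m)) = rng \<Lambda> (z (m, n))"
    "deg \<Lambda> (z (0, m)) = m" if "z \<in> infinite_paths \<Lambda>" for z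
    using infinite_pathsD[OF that, of 0 m] infinite_pathsD[OF that assms(2)] by simp_all
  ultimately have "y (0, m) = x (0, m) \<and> y (m, n) = x (m, n)"
    using x y(1) by (intro cmp_eq_cmpD) simp_all
  then show "y \<in> cylinder \<Lambda> (x (0, m))"
    using y(1) infinite_pathsD(4)[OF x, of 0 m] by (simp add: cylinder_def)
qed

lemma mem_cylinder_initial:
  assumes "x \<in> infinite_paths \<Lambda>"
  shows "x (0, n) \<in> mor \<Lambda>" "deg \<Lambda> (x (0, n)) = n" "x \<in> cylinder \<Lambda> (x (0, n))"
  using infinite_pathsD(1,4)[OF assms, of 0 n] assms by (simp_all add: cylinder_def)

text \<open>\<open>path_topology\<close> has the cylinders only as a subbase; they are in fact a
  base.\<close>

lemma openin_path_topology_cylinder: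
  assumes "openin (path_topology \<Lambda>) U" "x \<in> U"
  shows "\<exists>\<mu>\<in>mor \<Lambda>. x \<in> cylinder \<Lambda> \<mu> \<and> cylinder \<Lambda> \<mu> \<subseteq> U"
proof -
  have "generate_topology_on (cylinder \<Lambda> ` mor \<Lambda>) U"
    using assms(1) by (simp add: path_topology_def openin_topology_generated_by_iff)
  then show ?thesis
    using assms(2)
  proof (induction arbitrary: x)
    case (Int a b)
    then obtain \<mu> \<nu> where *: "\<mu> \<in> mor \<Lambda>" "x \<in> cylinder \<Lambda> \<mu>" "cylinder \<Lambda> \<mu> \<subseteq> a"
        "\<nu> \<in> mor \<Lambda>" "x \<in> cylinder \<Lambda> \<nu>" "cylinder \<Lambda> \<nu> \<subseteq> b"
      by (metis IntD1 IntD2)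
    \<comment> \<open>The sum is a common upper bound of both degrees, so the cylinder around x at
      this degree lies in both given cylinders.\<close>
    let ?n = "deg \<Lambda> \<mu> + deg \<Lambda> \<nu>"
    have x: "x \<in> infinite_paths \<Lambda>"
      using * by (auto simp: cylinder_def)
    have "cylinder \<Lambda> (x (0, ?n)) \<subseteq> a \<inter> b"
      using cylinder_antimono[OF x, of "deg \<Lambda> \<mu>" ?n] cylinder_antimono[OF x, of "deg \<Lambda> \<nu>" ?n] *
      by (auto simp: cylinder_def)
    moreover have "x \<in> cylinder \<Lambda> (x (0, ?n))" "x (0, ?n) \<in> mor \<Lambda>"
      using x infinite_pathsD[OF x, of 0 ?n] by (auto simp: cylinder_def)
    ultimately show ?case by blast
  next
    case (UN K)
    then obtain U where U: "U \<in> K" "x \<in> U" by blast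
    from UN.IH[OF this] U(1) show ?case by blast
  qed auto
qed

text \<open>An open set is the union of the cylinders inside it, and there are only countably many
  since \<open>mor \<Lambda>\<close> is countable.\<close>

lemma sigma_sets_path_topology:
  "sigma_sets (infinite_paths \<Lambda>) {U. openin (path_topology \<Lambda>) U} =
   sigma_sets (infinite_paths \<Lambda>) (cylinder \<Lambda> ` mor \<Lambda>)"
proof (rule sigma_sets_eqI)
  fix U assume "U \<in> {U. openin (path_topology \<Lambda>) U}"
  then have "U = \<Union> (cylinder \<Lambda> ` {\<mu> \<in> mor \<Lambda>. cylinder \<Lambda> \<mu> \<subseteq> U})"
    using openin_path_topology_cylinder[of U] by blast
  moreover have "\<Union> (cylinder \<Lambda> ` {\<mu> \<in> mor \<Lambda>. cylinder \<Lambda> \<mu> \<subseteq> U})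
      \<in> sigma_sets (infinite_paths \<Lambda>) (cylinder \<Lambda> ` mor \<Lambda>)"
  proof (rule sigma_sets_UNION)
    show "countable (cylinder \<Lambda> ` {\<mu> \<in> mor \<Lambda>. cylinder \<Lambda> \<mu> \<subseteq> U})"
      by (intro countable_image countable_subset[OF _ countable_mor]) auto
  qed auto
  ultimately show "U \<in> sigma_sets (infinite_paths \<Lambda>) (cylinder \<Lambda> ` mor \<Lambda>)"
    by simp
next
  fix U assume "U \<in> cylinder \<Lambda> ` mor \<Lambda>"
  then show "U \<in> sigma_sets (infinite_paths \<Lambda>) {U. openin (path_topology \<Lambda>) U}"
    by (auto intro!: sigma_sets.Basic topology_generated_by_Basis simp: path_topology_def)
qed

text \<open>The case of \<open>prefixed_segment\<close> with the vertex x(0, 0) as prefix, where the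
  shift is by 0. It turns conditions on x(p, q) into conditions on an initial segment.\<close>

lemma apply_eq_segment:
  assumes "x \<in> infinite_paths \<Lambda>" "p \<le> q"
  shows "x (p, q) = segment \<Lambda> (x (0, q)) p q"
proof -
  have "x \<in> cylinder \<Lambda> (x (0, 0))"
    by (rule mem_cylinder_initial(3)[OF assms(1)])
  from prefixed_segment[OF this assms(2)] show ?thesis
    using mem_cylinder_initial(2)[OF assms(1), of 0] infinite_pathsD(1,2)[OF assms(1), of 0 q]
      rng_id[of "x (0, q)"] by simp
qed

lemma Union_cylinder: "(\<Union>\<mu>\<in>paths \<Lambda> m. cylinder \<Lambda> \<mu>) = infinite_paths \<Lambda>"
proof
  show "infinite_paths \<Lambda> \<subseteq> (\<Union>\<mu>\<in>paths \<Lambda> m. cylinder \<Lambda> \<mu>)"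
    using mem_cylinder_initial[of _ m] by (fastforce simp: paths_def)
qed (auto simp: cylinder_def)

lemma cylinder_disjoint:
  assumes "\<mu> \<in> paths \<Lambda> m" "\<nu> \<in> paths \<Lambda> m" "\<mu> \<noteq> \<nu>"
  shows "cylinder \<Lambda> \<mu> \<inter> cylinder \<Lambda> \<nu> = {}"
  using assms by (auto simp: cylinder_def paths_def)

lemma cylinder_rng_disjoint:
  assumes "\<mu> \<in> mor \<Lambda>" "\<nu> \<in> mor \<Lambda>" "src \<Lambda> \<mu> \<noteq> rng \<Lambda> \<nu>"
  shows "cylinder \<Lambda> (src \<Lambda> \<mu>) \<inter> cylinder \<Lambda> \<nu> = {}"
  using cylinder_subset_rng[OF assms(2)] assms
  by (auto simp: cylinder_vertex)

text \<open>Two cylinders of incomparable degrees may overlap without being nested, so cylinders are not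
  stable under intersection; those whose degree is a multiple of \<open>(1, \<dots>, 1)\<close> are nested or
  disjoint, and they still generate the \<open>\<sigma>\<close>-algebra.\<close>

definition diag_cylinders :: "((nat ^ 'b) \<times> (nat ^ 'b) \<Rightarrow> 'a) set set" where
  "diag_cylinders = insert {} {cylinder \<Lambda> \<mu> | \<mu> N. \<mu> \<in> paths \<Lambda> (\<chi> i. N)}"

text \<open>A common point has initial segments \<open>\<mu>\<close> and \<open>\<nu>\<close>, and
  then \<open>cylinder_antimono\<close> applies.\<close>

lemma cylinder_nested:
  assumes "\<mu> \<in> paths \<Lambda> m" "\<nu> \<in> paths \<Lambda> n" "m \<le> n"
  shows "cylinder \<Lambda> \<mu> \<inter> cylinder \<Lambda> \<nu> = {} \<or> cylinder \<Lambda> \<nu> \<subseteq> cylinder \<Lambda> \<mu>"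
  using cylinder_antimono[OF _ assms(3)] assms(1,2) by (fastforce simp: cylinder_def paths_def)

lemma Int_stable_diag_cylinders: "Int_stable diag_cylinders"
proof -
  have "a \<inter> b \<in> diag_cylinders"
    if "a = cylinder \<Lambda> \<mu>" "b = cylinder \<Lambda> \<nu>" "\<mu> \<in> paths \<Lambda> (\<chi> i. N)" "\<nu> \<in> paths \<Lambda> (\<chi> i. N')" "N \<le> N'"
    for a b \<mu> \<nu> N N'
  proof -
    have "(\<chi> i. N) \<le> ((\<chi> i. N') :: nat ^ 'b)"
      using that(5) by (simp add: Finite_Cartesian_Product.less_eq_vec_def)
    from cylinder_nested[OF that(3,4) this] have "a \<inter> b = {} \<or> a \<inter> b = b"
      using that(1,2) by blast
    then show ?thesis
      using that by (auto simp: diag_cylinders_def)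
  qed
  note * = this
  have "a \<inter> b \<in> diag_cylinders" if ab: "a \<in> diag_cylinders" "b \<in> diag_cylinders" for a b
  proof (cases "a = {} \<or> b = {}")
    case False
    then obtain \<mu> N where "a = cylinder \<Lambda> \<mu>" "\<mu> \<in> paths \<Lambda> (\<chi> i. N)"
      using ab(1) by (auto simp: diag_cylinders_def)
    moreover from False obtain \<nu> N' where "b = cylinder \<Lambda> \<nu>" "\<nu> \<in> paths \<Lambda> (\<chi> i. N')"
      using ab(2) by (auto simp: diag_cylinders_def)
    ultimately show ?thesis
      using *[of a \<mu> b \<nu> N N'] *[of b \<nu> a \<mu> N' N] by (metis Int_commute nat_le_linear)
  qed (auto simp: diag_cylinders_def)
  then show ?thesis
    by (auto simp: Int_stable_def)
qed

lemma sigma_sets_diag_cylinders: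
  "sigma_sets (infinite_paths \<Lambda>) (cylinder \<Lambda> ` mor \<Lambda>) = sigma_sets (infinite_paths \<Lambda>) diag_cylinders"
proof (rule sigma_sets_eqI)
  fix a assume "a \<in> cylinder \<Lambda> ` mor \<Lambda>"
  then obtain \<mu> where \<mu>: "\<mu> \<in> mor \<Lambda>" "a = cylinder \<Lambda> \<mu>" by blast
  \<comment> \<open>With N the largest coordinate of d(\<mu>), every path in Z(\<mu>) has an initial
    segment of degree (N, ..., N) that extends \<open>\<mu>\<close>; \<open>K\<close> collects such
    segments.\<close>
  define N where "N = Max (range (vec_nth (deg \<Lambda> \<mu>)))"
  define K where "K = {\<kappa> \<in> paths \<Lambda> (\<chi> i. N). cylinder \<Lambda> \<kappa> \<subseteq> a}"
  have le: "deg \<Lambda> \<mu> \<le> (\<chi> i. N)"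
    unfolding N_def by (rule nat_vec_le_const_Max)
  have "x \<in> \<Union> (cylinder \<Lambda> ` K)" if "x \<in> a" for x
  proof -
    have x: "x \<in> infinite_paths \<Lambda>" "x (0, deg \<Lambda> \<mu>) = \<mu>"
      using that \<mu> by (auto simp: cylinder_def)
    have "x (0, \<chi> i. N) \<in> K"
      using cylinder_antimono[OF x(1) le] mem_cylinder_initial(1,2)[OF x(1)] x(2) \<mu>
      by (simp add: K_def paths_def)
    then show ?thesis
      using mem_cylinder_initial(3)[OF x(1)] by blast
  qed
  then have "a = \<Union> (cylinder \<Lambda> ` K)"
    by (auto simp: K_def)
  also have "\<dots> \<in> sigma_sets (infinite_paths \<Lambda>) diag_cylinders"
  proof (rule sigma_sets_UNION)
    show "countable (cylinder \<Lambda> ` K)"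
      by (intro countable_image countable_subset[OF _ countable_mor]) (auto simp: K_def paths_def)
  qed (auto simp: K_def diag_cylinders_def intro!: sigma_sets.Basic)
  finally show "a \<in> sigma_sets (infinite_paths \<Lambda>) diag_cylinders" .
next
  fix a assume "a \<in> diag_cylinders"
  then show "a \<in> sigma_sets (infinite_paths \<Lambda>) (cylinder \<Lambda> ` mor \<Lambda>)"
    by (auto simp: diag_cylinders_def paths_def intro: sigma_sets.Empty)
qed

end

section \<open>Measurability and scaling for the Perron-Frobenius measure\<close>

locale perron_frobenius_kgraph = k_graph \<Lambda> for \<Lambda> :: "('a, 'k::finite) kgraph" +
  fixes M :: "((nat ^ 'k) \<times> (nat ^ 'k) \<Rightarrow> 'a) measure"
  assumes finite: "finite_kgraph \<Lambda>" and pf: "pf_measure \<Lambda> M"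
begin

sublocale prob_space M
  using pf by (simp add: pf_measure_def)

lemma space_M: "space M = infinite_paths \<Lambda>"
  using pf by (simp add: pf_measure_def)

lemma sets_M: "sets M = sigma_sets (infinite_paths \<Lambda>) (cylinder \<Lambda> ` mor \<Lambda>)"
  using pf by (simp add: pf_measure_def sigma_sets_path_topology)

lemma sets_cylinder [measurable]: "\<mu> \<in> mor \<Lambda> \<Longrightarrow> cylinder \<Lambda> \<mu> \<in> sets M"
  unfolding sets_M by blast

lemma finite_paths: "Finite_Set.finite (paths \<Lambda> n)"
  using finite by (simp add: finite_kgraph_def)

text \<open>Finiteness of \<Lambda> makes this a finite union of cylinders, whatever the predicate
  \<open>P\<close> is. The measurability proofs reduce preimages of cylinders to this form.\<close>

lemma sets_initial: "{x \<in> infinite_paths \<Lambda>. P (x (0, n))} \<in> sets M"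
proof -
  have "{x \<in> infinite_paths \<Lambda>. P (x (0, n))} = (\<Union>\<mu>\<in>{\<mu> \<in> paths \<Lambda> n. P \<mu>}. cylinder \<Lambda> \<mu>)"
    using mem_cylinder_initial[of _ n] by (fastforce simp: paths_def cylinder_def)
  also have "\<dots> \<in> sets M"
    by (intro sets.finite_UN finite_subset[OF _ finite_paths[of n]]) (auto simp: paths_def)
  finally show ?thesis .
qed

lemma measurable_path_shift: "path_shift m \<in> M \<rightarrow>\<^sub>M M"
proof (rule measurable_sigma_sets[OF sets_M])
  show "cylinder \<Lambda> ` mor \<Lambda> \<subseteq> Pow (infinite_paths \<Lambda>)"
    by (auto simp: cylinder_def)
  show "path_shift m \<in> space M \<rightarrow> infinite_paths \<Lambda>"
    by (auto simp: space_M path_shift_infinite_paths)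
  fix A assume "A \<in> cylinder \<Lambda> ` mor \<Lambda>"
  then obtain \<nu> where \<nu>: "A = cylinder \<Lambda> \<nu>" by blast
  let ?q = "deg \<Lambda> \<nu> + m"
  have "path_shift m -` A \<inter> space M = {x \<in> infinite_paths \<Lambda>. x (m, ?q) = \<nu>}"
    by (auto simp: \<nu> space_M cylinder_def path_shift_infinite_paths)
  also have "\<dots> = {x \<in> infinite_paths \<Lambda>. segment \<Lambda> (x (0, ?q)) m ?q = \<nu>}"
    using apply_eq_segment[of _ m ?q] by auto
  finally show "path_shift m -` A \<inter> space M \<in> sets M"
    using sets_initial by simp
qed

lemma measurable_prefixing:
  assumes "\<mu> \<in> mor \<Lambda>"
  shows "prefixing \<Lambda> \<mu> \<in> restrict_space M (cylinder \<Lambda> (src \<Lambda> \<mu>)) \<rightarrow>\<^sub>M M"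
proof (rule measurable_sigma_sets[OF sets_M])
  let ?D = "cylinder \<Lambda> (src \<Lambda> \<mu>)"
  have D: "?D \<in> sets M" "?D \<subseteq> infinite_paths \<Lambda>"
    using assms by (auto simp: src_mor) (auto simp: cylinder_def)
  then have sp: "space (restrict_space M ?D) = ?D"
    by (auto simp: space_restrict_space space_M)
  show "cylinder \<Lambda> ` mor \<Lambda> \<subseteq> Pow (infinite_paths \<Lambda>)"
    by (auto simp: cylinder_def)
  show "prefixing \<Lambda> \<mu> \<in> space (restrict_space M ?D) \<rightarrow> infinite_paths \<Lambda>"
    unfolding sp using prefixing_works(1)[OF assms] by (fastforce simp: cylinder_def[of _ \<mu>])
  fix A assume "A \<in> cylinder \<Lambda> ` mor \<Lambda>"
  then obtain \<nu> where \<nu>: "A = cylinder \<Lambda> \<nu>" by blast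
  let ?q = "deg \<Lambda> \<nu>"
  \<comment> \<open>Whether \<mu>x lies in Z(\<nu>) is decided by x(0, d(\<nu>)) alone.\<close>
  have "prefixing \<Lambda> \<mu> x \<in> A \<longleftrightarrow> segment \<Lambda> (cmp \<Lambda> \<mu> (x (0, ?q))) 0 ?q = \<nu>" if "x \<in> ?D" for x
    using prefixed_segment[OF prefixing_works(1)[OF assms that], of 0 ?q]
      prefixing_works[OF assms that] by (simp add: \<nu> cylinder_def)
  then have "prefixing \<Lambda> \<mu> -` A \<inter> space (restrict_space M ?D) =
      ?D \<inter> {x \<in> infinite_paths \<Lambda>. segment \<Lambda> (cmp \<Lambda> \<mu> (x (0, ?q))) 0 ?q = \<nu>}"
    using D(2) by (auto simp: sp)
  also have "\<dots> \<in> sets (restrict_space M ?D)"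
    using D sets_initial by (subst sets_restrict_space_iff) (auto simp: sets.Int)
  finally show "prefixing \<Lambda> \<mu> -` A \<inter> space (restrict_space M ?D) \<in> sets (restrict_space M ?D)" .
qed

lemma measure_cylinderE:
  obtains \<xi> where "\<And>v. v \<in> vertices \<Lambda> \<Longrightarrow> \<xi> v > 0"
    "\<And>\<mu>. \<mu> \<in> mor \<Lambda> \<Longrightarrow> measure M (cylinder \<Lambda> \<mu>) = inverse (rho_pow \<Lambda> (deg \<Lambda> \<mu>)) * \<xi> (src \<Lambda> \<mu>)"
  using pf unfolding pf_measure_def pf_vector_def by blast

lemma src_vertex: "\<mu> \<in> mor \<Lambda> \<Longrightarrow> src \<Lambda> \<mu> \<in> vertices \<Lambda>"
  by (simp add: vertices_def src_mor rng_src)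

text \<open>Some cylinder of a given degree has positive measure, because finitely many of them cover the
  space; as \<open>inverse 0 = 0\<close>, this rules out \<open>rho_pow \<Lambda> n = 0\<close>.\<close>

lemma rho_pow_pos: "rho_pow \<Lambda> n > 0"
proof -
  obtain \<xi> where \<xi>: "\<And>v. v \<in> vertices \<Lambda> \<Longrightarrow> \<xi> v > 0"
    "\<And>\<mu>. \<mu> \<in> mor \<Lambda> \<Longrightarrow> measure M (cylinder \<Lambda> \<mu>) = inverse (rho_pow \<Lambda> (deg \<Lambda> \<mu>)) * \<xi> (src \<Lambda> \<mu>)"
    by (rule measure_cylinderE) blast
  have "1 = measure M (\<Union>\<mu>\<in>paths \<Lambda> n. cylinder \<Lambda> \<mu>)"
    using prob_space by (simp add: Union_cylinder space_M)
  also have "\<dots> \<le> (\<Sum>\<mu>\<in>paths \<Lambda> n. measure M (cylinder \<Lambda> \<mu>))"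
    using finite_paths by (intro finite_measure_subadditive_finite) (auto simp: paths_def)
  finally have "\<not> (\<Sum>\<mu>\<in>paths \<Lambda> n. measure M (cylinder \<Lambda> \<mu>)) \<le> 0"
    by linarith
  then obtain \<mu> where \<mu>: "\<mu> \<in> paths \<Lambda> n" "measure M (cylinder \<Lambda> \<mu>) > 0"
    using sum_nonpos[of "paths \<Lambda> n" "\<lambda>\<mu>. measure M (cylinder \<Lambda> \<mu>)"] not_le by blast
  then have "inverse (rho_pow \<Lambda> n) * \<xi> (src \<Lambda> \<mu>) > 0" "\<xi> (src \<Lambda> \<mu>) > 0"
    using \<xi> src_vertex by (auto simp: paths_def)
  then show ?thesis
    by (simp add: zero_less_mult_iff)
qed

lemma rho_pow_add: "rho_pow \<Lambda> (m + n) = rho_pow \<Lambda> m * rho_pow \<Lambda> n"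
  by (simp add: rho_pow_def power_add prod.distrib)

lemma measure_cylinder_pos:
  assumes "\<mu> \<in> mor \<Lambda>"
  shows "measure M (cylinder \<Lambda> \<mu>) > 0"
proof -
  obtain \<xi> where "\<And>v. v \<in> vertices \<Lambda> \<Longrightarrow> \<xi> v > 0"
    "\<And>\<mu>. \<mu> \<in> mor \<Lambda> \<Longrightarrow> measure M (cylinder \<Lambda> \<mu>) = inverse (rho_pow \<Lambda> (deg \<Lambda> \<mu>)) * \<xi> (src \<Lambda> \<mu>)"
    by (rule measure_cylinderE) blast
  then show ?thesis
    using assms src_vertex[OF assms] by (simp add: rho_pow_pos)
qed

text \<open>Since s(\<mu>\<nu>) = s(\<nu>), the Perron-Frobenius entry is unchanged, and only the
  power of \<rho>(\<Lambda>) picks up a factor.\<close>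

lemma emeasure_cylinder_cmp:
  assumes "\<mu> \<in> mor \<Lambda>" "\<nu> \<in> mor \<Lambda>" "src \<Lambda> \<mu> = rng \<Lambda> \<nu>"
  shows "emeasure M (cylinder \<Lambda> (cmp \<Lambda> \<mu> \<nu>)) =
    ennreal (inverse (rho_pow \<Lambda> (deg \<Lambda> \<mu>))) * emeasure M (cylinder \<Lambda> \<nu>)"
proof -
  obtain \<xi> where \<xi>:
    "\<And>\<mu>. \<mu> \<in> mor \<Lambda> \<Longrightarrow> measure M (cylinder \<Lambda> \<mu>) = inverse (rho_pow \<Lambda> (deg \<Lambda> \<mu>)) * \<xi> (src \<Lambda> \<mu>)"
    by (rule measure_cylinderE) blast
  have "measure M (cylinder \<Lambda> (cmp \<Lambda> \<mu> \<nu>)) =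
      inverse (rho_pow \<Lambda> (deg \<Lambda> \<mu>)) * measure M (cylinder \<Lambda> \<nu>)"
    using assms by (simp add: \<xi> cmp_mor deg_cmp src_cmp rho_pow_add)
  then show ?thesis
    using rho_pow_pos[of "deg \<Lambda> \<mu>"] by (simp add: emeasure_eq_measure flip: ennreal_mult)
qed

text \<open>Stated for every measurable \<open>A\<close>, not only for subsets of Z(s(\<mu>)), so
  that both sides are measures on the whole space and uniqueness on an intersection-stable generator
  applies.\<close>

lemma emeasure_shift_preimage:
  assumes \<mu>: "\<mu> \<in> mor \<Lambda>" and A: "A \<in> sets M"
  shows "emeasure M {y \<in> cylinder \<Lambda> \<mu>. path_shift (deg \<Lambda> \<mu>) y \<in> A} =
    ennreal (inverse (rho_pow \<Lambda> (deg \<Lambda> \<mu>))) * emeasure M (cylinder \<Lambda> (src \<Lambda> \<mu>) \<inter> A)"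
proof -
  let ?d = "deg \<Lambda> \<mu>" and ?Z = "cylinder \<Lambda> \<mu>" and ?D = "cylinder \<Lambda> (src \<Lambda> \<mu>)"
  let ?c = "ennreal (inverse (rho_pow \<Lambda> ?d))"
  let ?N1 = "distr (restrict_space M ?Z) M (path_shift ?d)"
  let ?N2 = "density M (\<lambda>x. ?c * indicator ?D x)"
  have Z: "?Z \<in> sets M" "?Z \<subseteq> space M" and D: "?D \<in> sets M" "?D \<subseteq> space M"
    using \<mu> by (auto simp: src_mor space_M) (auto simp: cylinder_def)
  have N1: "emeasure ?N1 B = emeasure M {y \<in> ?Z. path_shift ?d y \<in> B}" if "B \<in> sets M" for B
  proof -
    have "emeasure ?N1 B = emeasure (restrict_space M ?Z) (path_shift ?d -` B \<inter> space (restrict_space M ?Z))"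
      using that by (intro emeasure_distr measurable_restrict_space1 measurable_path_shift)
    also have "path_shift ?d -` B \<inter> space (restrict_space M ?Z) = {y \<in> ?Z. path_shift ?d y \<in> B}"
      using Z by (auto simp: space_restrict_space)
    finally show ?thesis
      using Z by (subst (asm) emeasure_restrict_space) auto
  qed
  have N2: "emeasure ?N2 B = ?c * emeasure M (?D \<inter> B)" if "B \<in> sets M" for B
  proof -
    have "emeasure ?N2 B = (\<integral>\<^sup>+x. ?c * indicator (?D \<inter> B) x \<partial>M)"
      using that D by (subst emeasure_density) (auto simp: indicator_inter_arith mult.assoc)
    also have "\<dots> = ?c * emeasure M (?D \<inter> B)"
      using that D by (intro nn_integral_cmult_indicator) auto
    finally show ?thesis .
  qed
  have cyl: "emeasure ?N1 (cylinder \<Lambda> \<nu>) = emeasure ?N2 (cylinder \<Lambda> \<nu>)" if \<nu>: "\<nu> \<in> mor \<Lambda>" for \<nu>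
  proof (cases "src \<Lambda> \<mu> = rng \<Lambda> \<nu>")
    case True
    then have "?D \<inter> cylinder \<Lambda> \<nu> = cylinder \<Lambda> \<nu>"
      using cylinder_subset_rng[OF \<nu>] by auto
    then show ?thesis
      using emeasure_cylinder_cmp[OF \<mu> \<nu> True]
      by (simp add: N1 N2 \<nu> sets_cylinder cylinder_cmp[OF \<mu> \<nu> True])
  next
    \<comment> \<open>The shift sends Z(\<mu>) into Z(s(\<mu>)), which misses Z(\<nu>) here, so both
      sides are 0.\<close>
    case False
    have empty: "{y \<in> ?Z. path_shift ?d y \<in> cylinder \<Lambda> \<nu>} = {}"
      using path_shift_cylinder[OF \<mu>] cylinder_rng_disjoint[OF \<mu> \<nu> False] by blast
    show ?thesis
      unfolding N1[OF sets_cylinder[OF \<nu>]] N2[OF sets_cylinder[OF \<nu>]] empty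
        cylinder_rng_disjoint[OF \<mu> \<nu> False] by simp
  qed
  have "?N1 = ?N2"
  proof (rule measure_eqI_generator_eq_countable[OF Int_stable_diag_cylinders])
    show "diag_cylinders \<subseteq> Pow (infinite_paths \<Lambda>)"
      by (auto simp: diag_cylinders_def cylinder_def)
    show "emeasure ?N1 X = emeasure ?N2 X" if "X \<in> diag_cylinders" for X
      using that cyl by (auto simp: diag_cylinders_def paths_def)
    show "sets ?N1 = sigma_sets (infinite_paths \<Lambda>) diag_cylinders"
      "sets ?N2 = sigma_sets (infinite_paths \<Lambda>) diag_cylinders"
      by (simp_all add: sets_M sigma_sets_diag_cylinders)
    \<comment> \<open>The uniqueness theorem needs a countable cover by generators of finite
      measure; the vertex cylinders, diagonal with N = 0, provide one.\<close>
    have *: "(\<chi> i. 0) = (0 :: nat ^ 'k)"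
      by (simp add: Finite_Cartesian_Product.vec_eq_iff)
    show "cylinder \<Lambda> ` paths \<Lambda> 0 \<subseteq> diag_cylinders"
      using * by (auto simp: diag_cylinders_def) metis
    show "\<Union> (cylinder \<Lambda> ` paths \<Lambda> 0) = infinite_paths \<Lambda>"
      by (rule Union_cylinder)
    show "countable (cylinder \<Lambda> ` paths \<Lambda> 0)"
      using finite_paths by (simp add: countable_finite)
    show "emeasure ?N1 a \<noteq> \<infinity>" if "a \<in> cylinder \<Lambda> ` paths \<Lambda> 0" for a
      using that by (auto simp: N1 paths_def sets_cylinder)
  qed
  then show ?thesis
    using N1[OF A] N2[OF A] by simp
qed

lemma rn_derivative_prefixing:
  assumes \<mu>: "\<mu> \<in> mor \<Lambda>"
  shows "rn_derivative_comp M (cylinder \<Lambda> (src \<Lambda> \<mu>)) (prefixing \<Lambda> \<mu>)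
    (\<lambda>_. inverse (rho_pow \<Lambda> (deg \<Lambda> \<mu>)))"
  unfolding rn_derivative_comp_def
proof (intro conjI ballI impI)
  let ?d = "deg \<Lambda> \<mu>" and ?D = "cylinder \<Lambda> (src \<Lambda> \<mu>)"
  fix E assume E: "E \<in> sets M" "E \<subseteq> ?D"
  have im: "prefixing \<Lambda> \<mu> ` E = {y \<in> cylinder \<Lambda> \<mu>. path_shift ?d y \<in> E}"
    by (rule prefixing_image[OF \<mu> E(2)])
  also have "\<dots> = cylinder \<Lambda> \<mu> \<inter> (path_shift ?d -` E \<inter> space M)"
    by (auto simp: space_M cylinder_def)
  also have "\<dots> \<in> sets M"
    using measurable_sets[OF measurable_path_shift E(1)] sets_cylinder[OF \<mu>] by blast
  finally show "prefixing \<Lambda> \<mu> ` E \<in> sets M" .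
  have "?D \<inter> E = E" using E(2) by auto
  then show "emeasure M (prefixing \<Lambda> \<mu> ` E) =
      (\<integral>\<^sup>+x\<in>E. ennreal (inverse (rho_pow \<Lambda> ?d)) \<partial>M)"
    unfolding im emeasure_shift_preimage[OF \<mu> E(1)]
    using E(1) by (simp add: nn_integral_cmult_indicator)
qed simp

section \<open>The axioms of a \<Lambda>-semibranching function system\<close>

text \<open>The range of prefixing by \<open>\<mu>\<close> is exactly Z(\<mu>), and the cylinders of
  one degree partition the path space; the required null sets are therefore empty.\<close>

lemma semibranching_prefixing:
  "semibranching_function_system M (paths \<Lambda> m) (\<lambda>\<mu>. cylinder \<Lambda> (src \<Lambda> \<mu>)) (prefixing \<Lambda>)"
  unfolding semibranching_function_system_def
proof (intro conjI ballI impI)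
  have mor: "\<mu> \<in> mor \<Lambda>" if "\<mu> \<in> paths \<Lambda> m" for \<mu>
    using that by (simp add: paths_def)
  show "Finite_Set.finite (paths \<Lambda> m)"
    by (rule finite_paths)
  have "(\<Union>\<mu>\<in>paths \<Lambda> m. prefixing \<Lambda> \<mu> ` cylinder \<Lambda> (src \<Lambda> \<mu>)) = space M"
    unfolding space_M Union_cylinder[of m, symmetric] by (intro SUP_cong prefixing_range mor refl)
  then show "space M - (\<Union>\<mu>\<in>paths \<Lambda> m. prefixing \<Lambda> \<mu> ` cylinder \<Lambda> (src \<Lambda> \<mu>)) \<in> null_sets M"
    by simp
  fix \<mu> assume \<mu>: "\<mu> \<in> paths \<Lambda> m"
  show "cylinder \<Lambda> (src \<Lambda> \<mu>) \<in> sets M"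
    by (intro sets_cylinder src_mor mor \<mu>)
  show "prefixing \<Lambda> \<mu> \<in> restrict_space M (cylinder \<Lambda> (src \<Lambda> \<mu>)) \<rightarrow>\<^sub>M M"
    by (intro measurable_prefixing mor \<mu>)
  show "\<exists>\<Phi>. rn_derivative_comp M (cylinder \<Lambda> (src \<Lambda> \<mu>)) (prefixing \<Lambda> \<mu>) \<Phi> \<and>
      (AE x in M. x \<in> cylinder \<Lambda> (src \<Lambda> \<mu>) \<longrightarrow> \<Phi> x > 0)"
    using rn_derivative_prefixing[OF mor[OF \<mu>]] rho_pow_pos by (intro exI conjI) auto
  fix \<nu> assume \<nu>: "\<nu> \<in> paths \<Lambda> m" "\<mu> \<noteq> \<nu>"
  show "prefixing \<Lambda> \<mu> ` cylinder \<Lambda> (src \<Lambda> \<mu>) \<inter> prefixing \<Lambda> \<nu> ` cylinder \<Lambda> (src \<Lambda> \<nu>) \<in> null_sets M"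
    using cylinder_disjoint[OF \<mu> \<nu>] by (simp add: prefixing_range mor \<mu> \<nu>(1))
qed

lemma Lambda_semibranching_prefixing:
  "Lambda_semibranching_function_system \<Lambda> M (\<lambda>\<mu>. cylinder \<Lambda> (src \<Lambda> \<mu>)) (prefixing \<Lambda>) path_shift"
  unfolding Lambda_semibranching_function_system_def
proof (intro conjI allI ballI impI)
  fix m
  show "semibranching_function_system M (paths \<Lambda> m) (\<lambda>\<mu>. cylinder \<Lambda> (src \<Lambda> \<mu>)) (prefixing \<Lambda>)"
    by (rule semibranching_prefixing)
  show "coding_map M (paths \<Lambda> m) (\<lambda>\<mu>. cylinder \<Lambda> (src \<Lambda> \<mu>)) (prefixing \<Lambda>) (path_shift m)"
    using measurable_path_shift prefixing_works(2) by (auto simp: coding_map_def paths_def)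
next
  fix v assume "v \<in> vertices \<Lambda>"
  then have v: "v \<in> mor \<Lambda>" "rng \<Lambda> v = v" "deg \<Lambda> v = 0"
    by (auto simp: vertices_def deg_id)
  then have src: "src \<Lambda> v = v"
    using vertex_eq(2) by blast
  show "0 < emeasure M (cylinder \<Lambda> (src \<Lambda> v))"
    using measure_cylinder_pos[OF v(1)] by (simp add: src emeasure_eq_measure)
  fix x assume "x \<in> cylinder \<Lambda> (src \<Lambda> v)"
  \<comment> \<open>A vertex has degree 0, so the shift is trivial and x itself meets the defining
    condition.\<close>
  then show "prefixing \<Lambda> v x = x"
    using v src by (intro prefixing_eqI) simp_all
next
  fix \<mu> \<nu> assume *: "\<mu> \<in> mor \<Lambda>" "\<nu> \<in> mor \<Lambda>" "src \<Lambda> \<mu> = rng \<Lambda> \<nu>"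
  have sub: "cylinder \<Lambda> \<nu> \<subseteq> cylinder \<Lambda> (src \<Lambda> \<mu>)"
    using cylinder_subset_rng[OF *(2)] *(3) by simp
  then have "prefixing \<Lambda> \<nu> ` cylinder \<Lambda> (src \<Lambda> \<nu>) - cylinder \<Lambda> (src \<Lambda> \<mu>) = {}"
    using prefixing_range[OF *(2)] by auto
  then show "prefixing \<Lambda> \<nu> ` cylinder \<Lambda> (src \<Lambda> \<nu>) - cylinder \<Lambda> (src \<Lambda> \<mu>) \<in> null_sets M"
    by (rule ssubst) simp
  \<comment> \<open>Holds at every point: Z(\<nu>) lies inside Z(s(\<mu>)), so the composite is
    defined on all of Z(s(\<nu>)), which is also the domain for \<mu>\<nu>.\<close>
  show "AE x in M. (x \<in> cylinder \<Lambda> (src \<Lambda> \<nu>) \<and> prefixing \<Lambda> \<nu> x \<in> cylinder \<Lambda> (src \<Lambda> \<mu>) \<longleftrightarrow>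
        x \<in> cylinder \<Lambda> (src \<Lambda> (cmp \<Lambda> \<mu> \<nu>))) \<and>
      (x \<in> cylinder \<Lambda> (src \<Lambda> (cmp \<Lambda> \<mu> \<nu>)) \<longrightarrow>
        prefixing \<Lambda> \<mu> (prefixing \<Lambda> \<nu> x) = prefixing \<Lambda> (cmp \<Lambda> \<mu> \<nu>) x)"
    unfolding src_cmp[OF *] using sub prefixing_works(1)[OF *(2)] prefixing_cmp[OF *]
    by (intro AE_I2) blast
next
  fix m n x
  show "path_shift m (path_shift n x) = path_shift (m + n) x"
    by (rule path_shift_path_shift)
qed

end

theorem proposition3p4:
  fixes \<Lambda> :: "('a, 'k::finite) kgraph"
    and M :: "((nat ^ 'k) \<times> (nat ^ 'k) \<Rightarrow> 'a) measure"
  assumes "k_graph \<Lambda>" and "finite_kgraph \<Lambda>" and "strongly_connected \<Lambda>"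
    and "pf_measure \<Lambda> M"
  shows "Lambda_semibranching_function_system \<Lambda> M
           (\<lambda>\<mu>. cylinder \<Lambda> (src \<Lambda> \<mu>)) (prefixing \<Lambda>) path_shift
         \<and> (\<forall>\<mu>\<in>mor \<Lambda>. prefixing \<Lambda> \<mu> ` cylinder \<Lambda> (src \<Lambda> \<mu>) \<subseteq> cylinder \<Lambda> \<mu>)"
proof -
  interpret perron_frobenius_kgraph \<Lambda> M
    using assms by (simp add: perron_frobenius_kgraph_def perron_frobenius_kgraph_axioms_def)
  show ?thesis
    using Lambda_semibranching_prefixing prefixing_range by simp
qed

end
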